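(* Let $a_0$ be the $1+3$-gon central configuration with central mass $m_c$. If $m_c\in[0,\frac{81+64\sqrt3}{249})$ and $a_0$ is collision nondegenerate, then for $1-e>0$ sufficiently small the elliptic relative equilibrium of eccentricity $e$ associated with $a_0$ is hyperbolic. Furthermore, if $m_c\in[0,\frac{\sqrt3}{24})$, then the elliptic relative equilibrium is hyperbolic for any $e\in[0,1)$.
   Context: The $1+3$-gon central configuration of the planar $4$-body problem consists of three unit masses at the vertices of a regular triangle, at unit distance from a mass $m_c$ placed at the center (up to normalization of scale). Put $J_{2j}=\begin{pmatrix}0&-I_j\\ I_j&0\end{pmatrix}$, $k=4$, $\mathbb{J}_{2}=\mathrm{diag}(J_2,J_2)$. For this configuration the regularized Hessian of the central configuration (the Hessian of $U$ on the ellipsoid $\{\sum m_i\|x_i\|^2=1\}$, divided by $U(a_0)$, on the complement of the translation, dilation and rotation directions, in Meyer–Schmidt coordinates) is $R=I_4+\mathcal{D}$ with $$\mathcal{D}=\begin{pmatrix}\frac12&0&-b&0\\0&\frac12&0&b\\-b&0&c&0\\0&b&0&c\end{pmatrix},\quad b=\frac{3\sqrt{3m_c(3+m_c)}}{2(1+\sqrt3m_c)},\quad c=\frac{\sqrt3(3+m_c)}{2(1+\sqrt3m_c)} .$$ Hyperbolicity. The elliptic relative equilibrium (ERE) of eccentricity $e\in[0,1)$ is the homographic solution with shape $a_0$ in which each body moves on a Keplerian ellipse of eccentricity $e$. It is hyperbolic if the monodromy matrix, restricted to the symplectic complement $E_3$ of the subspaces coming from translation, dilation and rotation symmetry, has no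 eigenvalue on the unit circle. In the Meyer–Schmidt reduction this restricted monodromy matrix is $\gamma_e(2\pi)$, where $\dot\gamma_e=J_{2k}\mathcal{B}(t)\gamma_e$, $\gamma_e(0)=I_{2k}$, $\mathcal{B}(t)=\begin{pmatrix} I_k&-\mathbb{J}_{k/2}\\ \mathbb{J}_{k/2}& I_k-\frac{R}{1+e\cos t}\end{pmatrix}$. Collision nondegeneracy: $a_0$ is collision nondegenerate if the system $z'=J_{2k}\hat B(\tau)z$, $\tau\in\mathbb{R}$, has no nonzero bounded solution on $\mathbb{R}$, where $\hat B=\begin{pmatrix} I_k&\frac Q4I_k-q\mathbb{J}_{k/2}\\ \frac Q4I_k+q\mathbb{J}_{k/2}& q^2I_k-R\end{pmatrix}$, $q(\tau)=\sqrt2/\cosh(\frac{\sqrt2\tau}{2})$, $Q(\tau)=\sqrt2\tanh(\frac{\sqrt2\tau}{2})$. *)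

theory Defs
  imports "HOL-Analysis.Analysis"
begin

section \<open>Block matrices\<close>

definition block_mat ::
    "real^'k^'k \<Rightarrow> real^'k^'k \<Rightarrow> real^'k^'k \<Rightarrow> real^'k^'k \<Rightarrow> real^('k+'k::finite)^('k+'k)" where
  "block_mat A B C D = (\<chi> i j. case i of
       Inl a \<Rightarrow> (case j of Inl b \<Rightarrow> A $ a $ b | Inr b \<Rightarrow> B $ a $ b)
     | Inr a \<Rightarrow> (case j of Inl b \<Rightarrow> C $ a $ b | Inr b \<Rightarrow> D $ a $ b))"

definition symp_J :: "real^('k+'k::finite)^('k+'k)" where
  "symp_J = block_mat 0 (- mat 1) (mat 1) 0"

text \<open>\<open>diag(J, J)\<close> with two \<open>2 \<times> 2\<close> blocks \<open>J\<close>: multiplication by the imaginary unit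
  on \<open>\<complex>\<^sup>2 = \<real>\<^sup>4\<close>. It differs from the \<open>4 \<times> 4\<close> instance of \<open>symp_J\<close>.\<close>

definition JJ :: "real^4^4" where
  "JJ = vector [vector [0, -1, 0,  0],
                vector [1,  0, 0,  0],
                vector [0,  0, 0, -1],
                vector [0,  0, 1,  0]]"

section \<open>Reduced linearized system of an elliptic relative equilibrium\<close>

text \<open>In this section \<open>R\<close> is the regularized Hessian of a central configuration of the planar
  4-body problem, in Meyer--Schmidt coordinates, so \<open>k = 4\<close>. The independent variable of the
  linearized system is the true anomaly, and one Keplerian period corresponds to \<open>2 * pi\<close>.\<close>

definition ere_B :: "real^4^4 \<Rightarrow> real \<Rightarrow> real \<Rightarrow> real^(4+4)^(4+4)" where
  "ere_B R e t = block_mat (mat 1) (- JJ) JJ (mat 1 - (1 / (1 + e * cos t)) *\<^sub>R R)"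

definition ere_fundamental_solution ::
    "real^4^4 \<Rightarrow> real \<Rightarrow> (real \<Rightarrow> real^(4+4)^(4+4)) \<Rightarrow> bool" where
  "ere_fundamental_solution R e \<gamma> \<longleftrightarrow>
     \<gamma> 0 = mat 1 \<and>
     (\<forall>t. (\<gamma> has_vector_derivative (symp_J ** ere_B R e t ** \<gamma> t)) (at t))"

definition complex_eigenvalue :: "real^'n^'n::finite \<Rightarrow> complex \<Rightarrow> bool" where
  "complex_eigenvalue M \<mu> \<longleftrightarrow>
     (\<exists>v. v \<noteq> 0 \<and> map_matrix complex_of_real M *v v = \<mu> *s v)"

text \<open>\<open>\<gamma> (2 * pi)\<close> is the monodromy matrix of the elliptic relative equilibrium, restricted to the
  symplectic complement of the translation, dilation and rotation subspaces.\<close>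

definition ere_hyperbolic :: "real^4^4 \<Rightarrow> real \<Rightarrow> bool" where
  "ere_hyperbolic R e \<longleftrightarrow>
     (\<exists>\<gamma>. ere_fundamental_solution R e \<gamma> \<and>
          (\<forall>\<mu>. complex_eigenvalue (\<gamma> (2 * pi)) \<mu> \<longrightarrow> cmod \<mu> \<noteq> 1))"

section \<open>Collision nondegeneracy\<close>

definition coll_q :: "real \<Rightarrow> real" where
  "coll_q \<tau> = sqrt 2 / cosh (sqrt 2 * \<tau> / 2)"

definition coll_Q :: "real \<Rightarrow> real" where
  "coll_Q \<tau> = sqrt 2 * tanh (sqrt 2 * \<tau> / 2)"

definition coll_B :: "real^4^4 \<Rightarrow> real \<Rightarrow> real^(4+4)^(4+4)" where
  "coll_B R \<tau> = block_mat
     (mat 1)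
     ((coll_Q \<tau> / 4) *\<^sub>R mat 1 - coll_q \<tau> *\<^sub>R JJ)
     ((coll_Q \<tau> / 4) *\<^sub>R mat 1 + coll_q \<tau> *\<^sub>R JJ)
     ((coll_q \<tau>)\<^sup>2 *\<^sub>R mat 1 - R)"

definition collision_nondegenerate :: "real^4^4 \<Rightarrow> bool" where
  "collision_nondegenerate R \<longleftrightarrow>
     (\<forall>z. (\<forall>\<tau>. (z has_vector_derivative ((symp_J ** coll_B R \<tau>) *v z \<tau>)) (at \<tau>)) \<and>
          bounded (range z) \<longrightarrow> (\<forall>\<tau>. z \<tau> = 0))"

section \<open>The regularized Hessian of the \<open>1 + 3\<close>-gon\<close>

definition b_coef :: "real \<Rightarrow> real" where
  "b_coef mc = 3 * sqrt (3 * mc * (3 + mc)) / (2 * (1 + sqrt 3 * mc))"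

definition c_coef :: "real \<Rightarrow> real" where
  "c_coef mc = sqrt 3 * (3 + mc) / (2 * (1 + sqrt 3 * mc))"

definition D_13gon :: "real \<Rightarrow> real^4^4" where
  "D_13gon mc =
     vector [vector [1/2,          0,         - b_coef mc, 0],
             vector [0,            1/2,       0,           b_coef mc],
             vector [- b_coef mc,  0,         c_coef mc,   0],
             vector [0,            b_coef mc, 0,           c_coef mc]]"

definition R_13gon :: "real \<Rightarrow> real^4^4" where
  "R_13gon mc = mat 1 + D_13gon mc"

section \<open>Derivation of the matrix from the Newtonian potential\<close>

text \<open>For \<open>mc > 0\<close> the matrix \<open>R_13gon mc\<close> is the Hessian of the potential, divided by its value, on
  the ellipsoid at the \<open>1 + 3\<close>-gon, in a mass-orthonormal complex basis of the complement of the
  translation, dilation and rotation directions (lemmas \<open>gon_basis_orthonormal\<close> and \<open>gon_hessian\<close>).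
  Positions are complex numbers and body 4 is the central one. For \<open>mc = 0\<close> the mass inner product
  degenerates, and \<open>R_13gon 0\<close> is the limit.\<close>

definition mass :: "real \<Rightarrow> 4 \<Rightarrow> real" where
  "mass mc i = (if i = 4 then mc else 1)"

definition potential :: "real \<Rightarrow> complex^4 \<Rightarrow> real" where
  "potential mc x =
     (\<Sum>i\<in>UNIV. \<Sum>j\<in>UNIV - {i}. mass mc i * mass mc j / dist (x $ i) (x $ j)) / 2"

definition mass_herm :: "real \<Rightarrow> complex^4 \<Rightarrow> complex^4 \<Rightarrow> complex" where
  "mass_herm mc x y = (\<Sum>i\<in>UNIV. of_real (mass mc i) * x $ i * cnj (y $ i))"

definition mass_norm :: "real \<Rightarrow> complex^4 \<Rightarrow> real" where
  "mass_norm mc x = sqrt (\<Sum>i\<in>UNIV. mass mc i * (norm (x $ i))\<^sup>2)"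

definition omega :: complex where "omega = Complex (- 1 / 2) (sqrt 3 / 2)"

definition gon :: "complex^4" where
  "gon = (1 / sqrt 3) *\<^sub>R vector [1, omega, omega\<^sup>2, 0]"

definition gon_dir1 :: "complex^4" where
  "gon_dir1 = (1 / sqrt 3) *\<^sub>R vector [1, omega\<^sup>2, omega, 0]"

definition gon_dir2 :: "real \<Rightarrow> complex^4" where
  "gon_dir2 mc = sqrt (mc / (3 * (3 + mc))) *\<^sub>R vector [-1, -1, -1, of_real (3 / mc)]"

text \<open>A real vector \<open>v\<close> is identified with the complex coordinates \<open>v\<^sub>1 + i v\<^sub>2\<close>
  and \<open>v\<^sub>3 + i v\<^sub>4\<close>.\<close>

definition gon_variation :: "real \<Rightarrow> real^4 \<Rightarrow> complex^4" where
  "gon_variation mc v =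
     Complex (v $ 1) (v $ 2) *s gon_dir1 + Complex (v $ 3) (v $ 4) *s gon_dir2 mc"

definition gon_curve :: "real \<Rightarrow> real^4 \<Rightarrow> real \<Rightarrow> complex^4" where
  "gon_curve mc v s =
     (1 / mass_norm mc (gon + s *\<^sub>R gon_variation mc v)) *\<^sub>R (gon + s *\<^sub>R gon_variation mc v)"

lemma vector_4_nth:
  "(vector [a, b, c, d] :: 'a::zero^4) $ 1 = a"
  "(vector [a, b, c, d] :: 'a::zero^4) $ 2 = b"
  "(vector [a, b, c, d] :: 'a::zero^4) $ 3 = c"
  "(vector [a, b, c, d] :: 'a::zero^4) $ 4 = d"
  unfolding vector_def by simp_all

lemma omega2: "omega\<^sup>2 = Complex (- 1 / 2) (- sqrt 3 / 2)"
  by (simp add: omega_def complex_eq_iff power2_eq_square)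

lemma quot_deriv2:
  fixes P Q S W :: real
  assumes P: "P > 0" and W: "W \<ge> 0"
  defines "g \<equiv> \<lambda>s. sqrt ((1 + W * s^2) / (P + 2 * Q * s + S * s^2))"
  defines "g1 \<equiv> \<lambda>s. (W * s / (1 + W * s^2) - (Q + S * s) / (P + 2 * Q * s + S * s^2)) * g s"
  shows "\<forall>\<^sub>F s in nhds 0. (g has_real_derivative g1 s) (at s)"
    and "(g1 has_real_derivative (W - S / P + 3 * Q^2 / P^2) / sqrt P) (at 0)"
proof -
  have "isCont (\<lambda>s. P + 2 * Q * s + S * s^2) 0" by (intro continuous_intros)
  hence "((\<lambda>s. P + 2 * Q * s + S * s^2) \<longlongrightarrow> P) (nhds 0)"
    using continuous_within_tendsto_compose'[of 0 UNIV _ "\<lambda>s. s" "nhds 0"] by (simp add: isCont_def tendsto_nhds_iff)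
  hence ev: "\<forall>\<^sub>F s in nhds 0. P + 2 * Q * s + S * s^2 > 0"
    using P by (rule order_tendstoD)
  have D: "(g has_real_derivative g1 s) (at s)" if B: "P + 2 * Q * s + S * s^2 > 0" for s
  proof -
    have A: "1 + W * s^2 > 0" using W by (smt (verit) mult_nonneg_nonneg zero_le_power2)
    define A' where "A' = 1 + W * s^2"
    define B' where "B' = P + 2 * Q * s + S * s^2"
    have pos: "A' > 0" "B' > 0" "A' / B' > 0" using A B by (auto simp: A'_def B'_def)
    have "(g has_real_derivative
        (inverse (sqrt (A' / B')) / 2 * ((2 * W * s * B' - A' * (2 * Q + 2 * S * s)) / (B' * B')))) (at s)"
      unfolding g_def A'_def B'_def
      using A B pos(3)[unfolded A'_def B'_def]
      by (auto intro!: derivative_eq_intros simp: algebra_simps divide_less_0_iff)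
    also have "inverse (sqrt (A' / B')) = sqrt (A' / B') * (B' / A')"
      using pos by (simp add: real_sqrt_divide field_simps)
    also have "sqrt (A' / B') * (B' / A') / 2 * ((2 * W * s * B' - A' * (2 * Q + 2 * S * s)) / (B' * B'))
       = (W * s / A' - (Q + S * s) / B') * sqrt (A' / B')"
      using pos by (simp add: field_simps)
    finally show ?thesis by (simp add: g1_def g_def A'_def B'_def)
  qed
  show "\<forall>\<^sub>F s in nhds 0. (g has_real_derivative g1 s) (at s)"
    using ev by eventually_elim (rule D)
  have g0: "(g has_real_derivative g1 0) (at 0)" using D[of 0] P by simp
  have v: "g 0 = 1 / sqrt P" by (simp add: g_def real_sqrt_divide)
  have "(g1 has_real_derivative
      ((W - (S * P - Q * (2 * Q)) / (P * P)) * g 0 + g1 0 * (- Q / P))) (at 0)"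
    unfolding g1_def
    by (rule derivative_eq_intros g0[unfolded g1_def] refl | use P in simp)+
  moreover have "(W - (S * P - Q * (2 * Q)) / (P * P)) * g 0 + g1 0 * (- Q / P)
     = (W - S / P + 3 * Q^2 / P^2) / sqrt P"
    using P by (simp add: g1_def v power2_eq_square divide_simps) (simp add: algebra_simps)
  ultimately show "(g1 has_real_derivative (W - S / P + 3 * Q^2 / P^2) / sqrt P) (at 0)"
    by simp
qed

lemma gon_variation_nth:
  "gon $ 1 = Complex (1 / sqrt 3) 0"
  "gon $ 2 = Complex (- 1 / (2 * sqrt 3)) (1 / 2)"
  "gon $ 3 = Complex (- 1 / (2 * sqrt 3)) (- 1 / 2)"
  "gon $ 4 = 0"
  "gon_dir1 $ 1 = Complex (1 / sqrt 3) 0"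
  "gon_dir1 $ 2 = Complex (- 1 / (2 * sqrt 3)) (- 1 / 2)"
  "gon_dir1 $ 3 = Complex (- 1 / (2 * sqrt 3)) (1 / 2)"
  "gon_dir1 $ 4 = 0"
proof -
  have e: "1 / sqrt 3 * (- 1 / 2) = - 1 / (2 * sqrt 3)"
    by (simp only: times_divide_times_eq mult_1 mult.commute)
  have e': "1 / sqrt 3 * (sqrt 3 / 2) = 1 / 2" "1 / sqrt 3 * (- sqrt 3 / 2) = - 1 / 2"
    by simp_all
  note d = vector_scaleR_component vector_4_nth complex_scaleR e e' mult_1_right mult_zero_right
  show "gon $ 1 = Complex (1 / sqrt 3) 0"
    "gon $ 2 = Complex (- 1 / (2 * sqrt 3)) (1 / 2)"
    "gon $ 3 = Complex (- 1 / (2 * sqrt 3)) (- 1 / 2)"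
    "gon $ 4 = 0"
    "gon_dir1 $ 1 = Complex (1 / sqrt 3) 0"
    "gon_dir1 $ 2 = Complex (- 1 / (2 * sqrt 3)) (- 1 / 2)"
    "gon_dir1 $ 3 = Complex (- 1 / (2 * sqrt 3)) (1 / 2)"
    "gon_dir1 $ 4 = 0"
    unfolding gon_def gon_dir1_def omega2 unfolding omega_def one_complex.code zero_complex.code
    by (simp_all only: d)
qed

lemma gon_dir2_nth:
  "i \<noteq> 4 \<Longrightarrow> gon_dir2 mc $ i = Complex (- sqrt (mc / (3 * (3 + mc)))) 0"
  "gon_dir2 mc $ 4 = Complex (sqrt (mc / (3 * (3 + mc))) * (3 / mc)) 0"
proof -
  assume "i \<noteq> 4"
  hence "i = 1 \<or> i = 2 \<or> i = 3" using exhaust_4[of i] by blast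
  hence "gon_dir2 mc $ i = sqrt (mc / (3 * (3 + mc))) *\<^sub>R (- 1)"
    unfolding gon_dir2_def vector_scaleR_component by (elim disjE) (simp_all only: vector_4_nth)
  thus "gon_dir2 mc $ i = Complex (- sqrt (mc / (3 * (3 + mc)))) 0"
    by (simp only: complex_eq_iff scaleR_complex.sel uminus_complex.sel one_complex.sel
      complex.sel mult_minus_right mult_1_right mult_zero_right minus_zero simp_thms)
next
  show "gon_dir2 mc $ 4 = Complex (sqrt (mc / (3 * (3 + mc))) * (3 / mc)) 0"
    unfolding gon_dir2_def vector_scaleR_component vector_4_nth
    by (simp only: complex_eq_iff scaleR_complex.sel Re_complex_of_real Im_complex_of_real
      complex.sel mult_zero_right simp_thms)
qed

lemma gon_basis_orthonormal:
  assumes "mc > 0"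
  shows "mass_herm mc gon gon = 1" "mass_herm mc gon_dir1 gon_dir1 = 1"
    "mass_herm mc (gon_dir2 mc) (gon_dir2 mc) = 1"
    "mass_herm mc gon gon_dir1 = 0" "mass_herm mc gon (gon_dir2 mc) = 0"
    "mass_herm mc gon_dir1 (gon_dir2 mc) = 0"
    "mass_herm mc gon (vec 1) = 0" "mass_herm mc gon_dir1 (vec 1) = 0"
    "mass_herm mc (gon_dir2 mc) (vec 1) = 0"
proof -
  define k where "k = sqrt (mc / (3 * (3 + mc)))"
  have k: "k\<^sup>2 * (3 + 9 / mc) = 1"
    using assms by (simp add: k_def field_simps add_pos_pos less_imp_neq[symmetric])
  define k' where "k' = k * (3 / mc)"
  have dn: "\<And>i. i \<noteq> 4 \<Longrightarrow> gon_dir2 mc $ i = Complex (- k) 0" "gon_dir2 mc $ 4 = Complex k' 0"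
    using gon_dir2_nth by (simp_all add: k_def k'_def)
  have k': "3 * k\<^sup>2 + mc * k'\<^sup>2 = 1" "mc * k' = 3 * k"
    using k assms by (simp_all add: k'_def power2_eq_square field_simps)
  define r where "r = 1 / sqrt (3::real)"
  have r: "r\<^sup>2 = 1 / 3" "1 / sqrt 3 = r" "1 / (2 * sqrt 3) = r / 2" "- 1 / (2 * sqrt 3) = - r / 2"
    by (simp_all add: r_def power_divide)
  have rr: "r * r = 1 / 3"
    using r(1) by (simp only: power2_eq_square)
  note d = mass_herm_def sum_4 mass_def complex_eq_iff gon_variation_nth dn
  show "mass_herm mc gon gon = 1" "mass_herm mc gon_dir1 gon_dir1 = 1"
    "mass_herm mc gon gon_dir1 = 0" "mass_herm mc gon (vec 1) = 0"
    "mass_herm mc gon_dir1 (vec 1) = 0" "mass_herm mc gon (gon_dir2 mc) = 0"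
    "mass_herm mc gon_dir1 (gon_dir2 mc) = 0"
    by (simp_all add: d r rr)
  show "mass_herm mc (gon_dir2 mc) (gon_dir2 mc) = 1"
    using k'(1) by (simp add: d power2_eq_square)
  show "mass_herm mc (gon_dir2 mc) (vec 1) = 0"
    using k'(2) by (simp add: d)
qed

lemma mass_norm_gon_variation:
  assumes "mc > 0"
  shows "mass_norm mc (gon + s *\<^sub>R gon_variation mc v) = sqrt (1 + (v \<bullet> v) * s\<^sup>2)"
proof -
  define k where "k = sqrt (mc / (3 * (3 + mc)))"
  have k: "k\<^sup>2 * (3 + 9 / mc) = 1"
    using assms by (simp add: k_def field_simps add_pos_pos less_imp_neq[symmetric])
  define k' where "k' = k * (3 / mc)"
  have dn: "\<And>i. i \<noteq> 4 \<Longrightarrow> gon_dir2 mc $ i = Complex (- k) 0" "gon_dir2 mc $ 4 = Complex k' 0"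
    using gon_dir2_nth by (simp_all add: k_def k'_def)

  have k': "3 * k\<^sup>2 + mc * k'\<^sup>2 = 1" "mc * k' = 3 * k"
    using k assms by (simp_all add: k'_def power2_eq_square field_simps)
  define r where "r = 1 / sqrt (3::real)"
  have r: "r\<^sup>2 = 1 / 3" "1 / sqrt 3 = r" "1 / (2 * sqrt 3) = r / 2" "- 1 / (2 * sqrt 3) = - r / 2"
    by (simp_all add: r_def power_divide)
  have rr: "r * r = 1 / 3" "\<And>a. r * (r * a) = a / 3"
    using r(1) by (auto simp: power2_eq_square simp flip: mult.assoc)
  have kk: "k' * (k' * (mc * a)) = a - 3 * (k * (k * a))" for a
  proof -
    have "k' * (k' * (mc * a)) = (mc * k'\<^sup>2) * a" by (simp add: power2_eq_square)
    also have "mc * k'\<^sup>2 = 1 - 3 * k\<^sup>2" using k' by simp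
    finally show ?thesis by (simp add: power2_eq_square algebra_simps)
  qed
  have "(\<Sum>i\<in>UNIV. mass mc i * (norm ((gon + s *\<^sub>R gon_variation mc v) $ i))\<^sup>2) =
        1 + (v \<bullet> v) * s\<^sup>2"
    unfolding inner_vec_def sum_4 cmod_power2
    apply (simp add: mass_def gon_variation_def gon_variation_nth dn r)
    by (simp add: rr kk algebra_simps power2_eq_square add_divide_distrib diff_divide_distrib)
  thus ?thesis unfolding mass_norm_def by simp
qed

lemma potential_sum:
  "potential mc x = 1 / dist (x $ 1) (x $ 2) + 1 / dist (x $ 1) (x $ 3) + 1 / dist (x $ 2) (x $ 3)
     + mc / dist (x $ 1) (x $ 4) + mc / dist (x $ 2) (x $ 4) + mc / dist (x $ 3) (x $ 4)"
proof -
  have e: "(\<Sum>j\<in>UNIV - {i}. mass mc i * mass mc j / dist (x $ i) (x $ j)) =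
      (\<Sum>j\<in>UNIV. mass mc i * mass mc j / dist (x $ i) (x $ j))" for i
    by (rule sum.mono_neutral_left) auto
  show ?thesis unfolding potential_def e sum_4
    by (simp add: mass_def dist_commute[of "x $ 2" "x $ 1"] dist_commute[of "x $ 3" "x $ 1"]
      dist_commute[of "x $ 3" "x $ 2"] dist_commute[of "x $ 4"] mult.commute[of mc 2])
qed

lemma inv_dist_curve:
  fixes a b p q :: complex
  assumes "N > 0"
  shows "1 / dist ((1 / sqrt N) *\<^sub>R (a + s *\<^sub>R p)) ((1 / sqrt N) *\<^sub>R (b + s *\<^sub>R q)) =
    sqrt (N / ((a - b) \<bullet> (a - b) + 2 * ((a - b) \<bullet> (p - q)) * s + ((p - q) \<bullet> (p - q)) * s\<^sup>2))"
proof -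
  have "(1 / sqrt N) *\<^sub>R (a + s *\<^sub>R p) - (1 / sqrt N) *\<^sub>R (b + s *\<^sub>R q) =
    (1 / sqrt N) *\<^sub>R ((a - b) + s *\<^sub>R (p - q))" by (simp add: algebra_simps)
  moreover have "norm (u + s *\<^sub>R w) = sqrt (u \<bullet> u + 2 * (u \<bullet> w) * s + (w \<bullet> w) * s\<^sup>2)" for u w :: complex
    unfolding norm_eq_sqrt_inner
    by (simp add: inner_add_left inner_add_right inner_commute[of w u] power2_eq_square algebra_simps)
  ultimately show ?thesis using assms by (simp add: dist_norm real_sqrt_divide)
qed

lemma deriv2_of:
  fixes f f1 :: "real \<Rightarrow> real"
  assumes "\<forall>\<^sub>F s in nhds 0. (f has_real_derivative f1 s) (at s)"
    "(f1 has_real_derivative c) (at 0)"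
  shows "(deriv ^^ 2) f 0 = c"
proof -
  have "\<forall>\<^sub>F s in nhds 0. deriv f s = f1 s"
    using assms(1) by eventually_elim (rule DERIV_imp_deriv)
  hence "deriv (deriv f) 0 = deriv f1 0" by (rule deriv_cong_ev) simp
  thus ?thesis using assms(2) by (simp add: numeral_2_eq_2 DERIV_imp_deriv)
qed

lemma gon_hessian:
  assumes mc: "mc > 0"
  shows "(deriv ^^ 2) (\<lambda>s. potential mc (gon_curve mc v s)) 0 / potential mc gon
         = v \<bullet> (R_13gon mc *v v)"
proof -
  define w where "w = gon_variation mc v"
  define W where "W = v \<bullet> v"
  have W: "W \<ge> 0" by (simp add: W_def)
  have N: "1 + W * s\<^sup>2 > 0" for s using W by (smt (verit) mult_nonneg_nonneg zero_le_power2)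
  define P where "P = (\<lambda>i j. (gon $ i - gon $ j) \<bullet> (gon $ i - gon $ j))"
  define Q where "Q = (\<lambda>i j. (gon $ i - gon $ j) \<bullet> (w $ i - w $ j))"
  define S where "S = (\<lambda>i j. (w $ i - w $ j) \<bullet> (w $ i - w $ j))"
  define g where "g = (\<lambda>i j s. sqrt ((1 + W * s^2) / (P i j + 2 * Q i j * s + S i j * s^2)))"
  define g1 where "g1 = (\<lambda>i j s. (W * s / (1 + W * s^2) - (Q i j + S i j * s) /
      (P i j + 2 * Q i j * s + S i j * s^2)) * g i j s)"
  define h where "h = (\<lambda>i j. (W - S i j / P i j + 3 * (Q i j)^2 / (P i j)^2) / sqrt (P i j))"
  have d: "1 / dist (gon_curve mc v s $ i) (gon_curve mc v s $ j) = g i j s" for i j s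
    unfolding gon_curve_def mass_norm_gon_variation[OF mc]
    using inv_dist_curve[OF N[of s], of "gon $ i" s "w $ i" "gon $ j" "w $ j"]
    by (simp add: g_def P_def Q_def S_def w_def W_def del: inner_diff_left inner_diff_right scaleR_conv_of_real)
  have pot: "potential mc (gon_curve mc v s) = g 1 2 s + g 1 3 s + g 2 3 s
     + mc * g 1 4 s + mc * g 2 4 s + mc * g 3 4 s" for s
    unfolding potential_sum d[symmetric] by simp
  have r: "1 / sqrt 3 * (1 / sqrt 3) = (1 / 3 :: real)" by simp
  have P: "P 1 2 = 1" "P 1 3 = 1" "P 2 3 = 1" "P 1 4 = 1/3" "P 2 4 = 1/3" "P 3 4 = 1/3"
    by (simp_all add: P_def gon_variation_nth inner_complex_def power2_eq_square field_simps)
  have g: "\<forall>\<^sub>F s in nhds 0. (g i j has_real_derivative g1 i j s) (at s)"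
       "(g1 i j has_real_derivative h i j) (at 0)" if "P i j > 0" for i j
    using quot_deriv2[OF that W, of "Q i j" "S i j"] unfolding g_def g1_def h_def by auto
  define H where "H = h 1 2 + h 1 3 + h 2 3 + mc * h 1 4 + mc * h 2 4 + mc * h 3 4"
  have "(deriv ^^ 2) (\<lambda>s. potential mc (gon_curve mc v s)) 0 = H"
    unfolding pot
  proof (rule deriv2_of)
    have "\<forall>\<^sub>F s in nhds 0. (g 1 2 has_real_derivative g1 1 2 s) (at s)"
      "\<forall>\<^sub>F s in nhds 0. (g 1 3 has_real_derivative g1 1 3 s) (at s)"
      "\<forall>\<^sub>F s in nhds 0. (g 2 3 has_real_derivative g1 2 3 s) (at s)"
      "\<forall>\<^sub>F s in nhds 0. (g 1 4 has_real_derivative g1 1 4 s) (at s)"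
      "\<forall>\<^sub>F s in nhds 0. (g 2 4 has_real_derivative g1 2 4 s) (at s)"
      "\<forall>\<^sub>F s in nhds 0. (g 3 4 has_real_derivative g1 3 4 s) (at s)"
      by (intro g; simp add: P)+
    thus "\<forall>\<^sub>F s in nhds 0. ((\<lambda>s. g 1 2 s + g 1 3 s + g 2 3 s
        + mc * g 1 4 s + mc * g 2 4 s + mc * g 3 4 s) has_real_derivative
        (g1 1 2 s + g1 1 3 s + g1 2 3 s
        + mc * g1 1 4 s + mc * g1 2 4 s + mc * g1 3 4 s)) (at s)"
      by eventually_elim (intro DERIV_add DERIV_cmult)
    show "((\<lambda>s. g1 1 2 s + g1 1 3 s + g1 2 3 s
        + mc * g1 1 4 s + mc * g1 2 4 s + mc * g1 3 4 s) has_real_derivative H) (at 0)"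
      unfolding H_def by (intro DERIV_add DERIV_cmult g) (simp_all add: P)
  qed
  moreover have "potential mc gon = 3 + 3 * sqrt 3 * mc"
  proof -
    have "dist (gon $ i) (gon $ j) = sqrt (P i j)" for i j
      by (simp add: P_def dist_norm norm_eq_sqrt_inner)
    thus ?thesis unfolding potential_sum by (simp add: P real_sqrt_divide)
  qed
  moreover have "H = (3 + 3 * sqrt 3 * mc) * (v \<bullet> (R_13gon mc *v v))"
  proof -
    define r where "r = 1 / sqrt (3::real)"
    have r: "r\<^sup>2 = 1 / 3" "1 / sqrt 3 = r" "1 / (2 * sqrt 3) = r / 2" "- 1 / (2 * sqrt 3) = - r / 2"
      by (simp_all add: r_def power_divide)
    have rr: "r * r = 1 / 3" "\<And>a. r * (r * a) = a / 3"
      using r(1) by (auto simp: power2_eq_square simp flip: mult.assoc)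
    define k where "k = sqrt (mc / (3 * (3 + mc)))"
    have k2: "k\<^sup>2 * (3 * (3 + mc)) = mc"
      using mc by (simp add: k_def)
    define k' where "k' = k * (3 / mc)"
  have dn: "\<And>i. i \<noteq> 4 \<Longrightarrow> gon_dir2 mc $ i = Complex (- k) 0" "gon_dir2 mc $ 4 = Complex k' 0"
    using gon_dir2_nth by (simp_all add: k_def k'_def)

    define m where "m = k + k'"
    have m: "mc * m = (3 + mc) * k" using mc by (simp add: m_def k'_def field_simps)
    have m2: "3 * (mc * m\<^sup>2) = 3 + mc"
    proof -
      have "3 * (mc * m\<^sup>2) * mc = (3 + mc) * mc" using m k2 by algebra
      thus ?thesis using mc by simp
    qed
    define x where "x = v $ 1"
    define y where "y = v $ 2"
    define x' where "x' = v $ 3"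
    define y' where "y' = v $ 4"
    note xs = x_def[symmetric] y_def[symmetric] x'_def[symmetric] y'_def[symmetric]
    have S3: "S 1 2 = x\<^sup>2 + y\<^sup>2" "S 1 3 = x\<^sup>2 + y\<^sup>2" "S 2 3 = x\<^sup>2 + y\<^sup>2"
      unfolding S_def w_def gon_variation_def
      by (simp_all add: gon_variation_nth dn inner_complex_def r xs) (simp_all add: rr algebra_simps power2_eq_square add_divide_distrib diff_divide_distrib)?
    have Q3: "Q 1 2 = x / 2 - 3 * r / 2 * y" "Q 1 3 = x / 2 + 3 * r / 2 * y" "Q 2 3 = - x"
      unfolding Q_def w_def gon_variation_def
      by (simp_all add: gon_variation_nth dn inner_complex_def r xs) (simp_all add: rr algebra_simps power2_eq_square add_divide_distrib diff_divide_distrib)?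
    have S4: "S 1 4 = (r * x - m * x')\<^sup>2 + (r * y - m * y')\<^sup>2"
       "S 2 4 = (- r * x / 2 + y / 2 - m * x')\<^sup>2 + (- x / 2 - r * y / 2 - m * y')\<^sup>2"
       "S 3 4 = (- r * x / 2 - y / 2 - m * x')\<^sup>2 + (x / 2 - r * y / 2 - m * y')\<^sup>2"
      unfolding S_def w_def gon_variation_def m_def
      by (simp_all add: gon_variation_nth dn inner_complex_def r xs)
         (simp_all add: algebra_simps power2_eq_square)?
    have Q4: "Q 1 4 = r * (r * x - m * x')"
       "Q 2 4 = - r / 2 * (- r * x / 2 + y / 2 - m * x') + (- x / 2 - r * y / 2 - m * y') / 2"
       "Q 3 4 = - r / 2 * (- r * x / 2 - y / 2 - m * x') - (x / 2 - r * y / 2 - m * y') / 2"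
      unfolding Q_def w_def gon_variation_def m_def
      by (simp_all add: gon_variation_nth dn inner_complex_def r xs)
         (simp_all add: algebra_simps power2_eq_square)
    have WW: "W = x\<^sup>2 + y\<^sup>2 + x'\<^sup>2 + y'\<^sup>2"
      by (simp add: W_def inner_vec_def sum_4 xs power2_eq_square)
    define t where "t = sqrt (3::real)"
    have t: "t\<^sup>2 = 3" "3 * r = t" by (simp_all add: t_def r_def real_div_sqrt)
    have s3: "1 / sqrt (1 / 3) = t" by (simp add: real_sqrt_divide t_def)
    have A: "h 1 2 + h 1 3 + h 2 3 = 3 * W - 3 * (x\<^sup>2 + y\<^sup>2) + 9 / 2 * (x\<^sup>2 + y\<^sup>2)"
      unfolding h_def P S3 Q3 by (simp add: rr algebra_simps power2_eq_square add_divide_distrib diff_divide_distrib)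
    have h4: "h i 4 = t * (W - 3 * S i 4 + 27 * (Q i 4)\<^sup>2)" if "P i 4 = 1 / 3" for i
    proof -
      have "h i 4 = (1 / sqrt (1 / 3)) * (W - 3 * S i 4 + 27 * (Q i 4)\<^sup>2)"
        unfolding h_def that by (simp add: power2_eq_square)
      thus ?thesis unfolding s3 .
    qed
    have SS: "S 1 4 + S 2 4 + S 3 4 = x\<^sup>2 + y\<^sup>2 + 3 * m\<^sup>2 * (x'\<^sup>2 + y'\<^sup>2)"
      unfolding S4 by (simp add: rr algebra_simps power2_eq_square add_divide_distrib diff_divide_distrib)
    have QQ: "27 * ((Q 1 4)\<^sup>2 + (Q 2 4)\<^sup>2 + (Q 3 4)\<^sup>2) =
       9 / 2 * ((x\<^sup>2 + y\<^sup>2) + 3 * m\<^sup>2 * (x'\<^sup>2 + y'\<^sup>2)) - 27 * r * m * (x * x' - y * y')"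
      unfolding Q4 by (simp add: rr algebra_simps power2_eq_square add_divide_distrib diff_divide_distrib)
    have B: "h 1 4 + h 2 4 + h 3 4 = t * (3 * W + 3 / 2 * (x\<^sup>2 + y\<^sup>2 + 3 * m\<^sup>2 * (x'\<^sup>2 + y'\<^sup>2))
         - 9 * t * m * (x * x' - y * y'))"
      proof -
      have "h 1 4 + h 2 4 + h 3 4 = t * (3 * W - 3 * (S 1 4 + S 2 4 + S 3 4)
          + 27 * ((Q 1 4)\<^sup>2 + (Q 2 4)\<^sup>2 + (Q 3 4)\<^sup>2))"
        unfolding h4[OF P(4)] h4[OF P(5)] h4[OF P(6)] by (simp add: algebra_simps)
      thus ?thesis unfolding SS QQ t(2)[symmetric] by (simp add: algebra_simps)
    qed
    have H: "H = 3 * W + 3 / 2 * (x\<^sup>2 + y\<^sup>2) + mc * (t * (3 * W + 3 / 2 * (x\<^sup>2 + y\<^sup>2 + 3 * m\<^sup>2 * (x'\<^sup>2 + y'\<^sup>2))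
         - 9 * t * m * (x * x' - y * y')))"
      proof -
      have "H = (h 1 2 + h 1 3 + h 2 3) + mc * (h 1 4 + h 2 4 + h 3 4)"
        unfolding H_def by (simp add: algebra_simps)
      thus ?thesis unfolding A B by (simp add: algebra_simps)
    qed
    have m_pos: "m > 0" using mc by (auto simp: m_def k'_def k_def intro!: add_pos_pos mult_pos_pos divide_pos_pos)
    have "3 * mc * (3 + mc) = (3 * (mc * m))\<^sup>2"
      unfolding m2[symmetric] by (simp add: power2_eq_square algebra_simps)
    hence "sqrt (3 * mc * (3 + mc)) = sqrt ((3 * (mc * m))\<^sup>2)"
      by (rule arg_cong)
    hence sq: "sqrt (3 * mc * (3 + mc)) = 3 * (mc * m)"
      using m_pos mc by (metis real_sqrt_abs abs_of_pos mult_pos_pos zero_less_numeral)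
    have den: "1 + t * mc > 0" using mc by (simp add: t_def add_pos_pos)
    have b: "2 * (1 + t * mc) * b_coef mc = 9 * (mc * m)"
      unfolding b_coef_def sq t_def[symmetric] using den by simp
    have c: "2 * (1 + t * mc) * c_coef mc = t * (3 + mc)"
      unfolding c_coef_def t_def[symmetric] using den by simp
    have vRv: "v \<bullet> (R_13gon mc *v v) = W + (x\<^sup>2 + y\<^sup>2) / 2 + c_coef mc * (x'\<^sup>2 + y'\<^sup>2)
        - 2 * b_coef mc * (x * x' - y * y')"
      unfolding R_13gon_def W_def matrix_vector_mult_add_rdistrib inner_add_right
        matrix_vector_mul_lid
      by (simp add: D_13gon_def inner_vec_def matrix_vector_mult_def sum_4 vector_4_nth xs
        power2_eq_square algebra_simps add_divide_distrib)
    have "(3 + 3 * t * mc) * (v \<bullet> (R_13gon mc *v v)) = 3 * (1 + t * mc) * (W + (x\<^sup>2 + y\<^sup>2) / 2)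
        + 3 / 2 * (2 * (1 + t * mc) * c_coef mc) * (x'\<^sup>2 + y'\<^sup>2)
        - 3 * (2 * (1 + t * mc) * b_coef mc) * (x * x' - y * y')"
      unfolding vRv by (simp add: algebra_simps add_divide_distrib)
    also have "\<dots> = 3 * (1 + t * mc) * (W + (x\<^sup>2 + y\<^sup>2) / 2)
        + 3 / 2 * (t * (3 * (mc * m\<^sup>2))) * (x'\<^sup>2 + y'\<^sup>2)
        - 9 * t\<^sup>2 * (mc * m) * (x * x' - y * y')"
      unfolding b c m2 t(1) by simp
    also have "\<dots> = H"
      unfolding H by (simp add: algebra_simps power2_eq_square add_divide_distrib)
    finally show ?thesis unfolding t_def by simp
  qed
  moreover have "3 + 3 * sqrt 3 * mc > 0" using mc by (simp add: add_pos_pos)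
  ultimately show ?thesis by simp
qed

end

theory Submission
  imports Defs
begin

text \<open>An eigenvalue on the unit circle gives a complex solution \<open>(p, x)\<close> of the linearized system,
  with \<open>x' = p - JJ x\<close>, on which every Hermitian form is \<open>2 * pi\<close>-periodic in time.
  The bound \<open>mc < sqrt 3 / 24\<close> means \<open>D > 0\<close>. Then the form
  \<open>p \<bullet> x + (e sin t / (1 + e cos t)) |x|\<^sup>2\<close> is strictly increasing along solutions, which contradicts
  periodicity for every \<open>e\<close>.

  The bound \<open>mc < (81 + 64 sqrt 3) / 249\<close> means \<open>R > 0\<close>. Then \<open>p \<bullet> x\<close> increases fast for \<open>t\<close> near
  \<open>pi\<close>, where \<open>R / (1 + e cos t)\<close> is large. This controls a periodic solution near \<open>pi\<close> by its values
  at the two ends of a fixed interval, and elsewhere the coefficients are bounded uniformly in \<open>e\<close>.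
  Hence, in the norm of the collision system, the solution is bounded by its value at \<open>t = 0\<close> with
  a constant independent of \<open>e\<close>. As \<open>e\<close> tends to 1, a subsequence of normalized solutions converges, in
  the time of the collision system, to a nonzero bounded solution of that system.\<close>

section \<open>Linear differential equations\<close>

text \<open>As \<open>e\<close> tends to 1 the coefficient \<open>1 / (1 + e * cos t)\<close> blows
  up at \<open>t = pi\<close>, so a Gronwall estimate over a whole period is not uniform in
  \<open>e\<close>. The time change \<open>true_anomaly\<close>, the same for every
  \<open>e\<close>, sends \<open>pi\<close> to infinity and leaves the collision system plus a
  perturbation that vanishes locally uniformly. A limit on compact time intervals is then easy to
  get, and it is nonzero because the data are normalized at \<open>t = 0\<close>, which is \<tau> =
  0. The hard part is that the limit stays bounded on the whole line, and this alone uses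
  \<open>R > 0\<close>. Periodicity enters there a second time: since the state at
  \<open>2 * pi\<close> has the same size as at 0, the interval around \<open>pi\<close> is reached
  with control from both sides. The eigenvector is carried as a pair of real solutions. The
  monodromy matrix rotates the pair, so a quadratic form summed over both members is periodic,
  although neither summand need be. Both thresholds are determinant conditions: the Hessian splits
  into two copies of one binary form, positive for \<open>D\<close> iff \<open>b^2 < c / 2\<close>
  and for \<open>R\<close> iff \<open>b^2 < 3 / 2 * (1 + c)\<close>.\<close>

lemma global_antiderivative:
  fixes g :: "real \<Rightarrow> 'a::banach"
  assumes "continuous_on UNIV g"
  shows "\<exists>G. G 0 = 0 \<and> (\<forall>t. (G has_vector_derivative g t) (at t))"
proof -
  \<comment> \<open>At least one of the two intervals is empty or a single point, so this is the
    signed integral from 0 to \<open>t\<close>.\<close>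
  define G where "G = (\<lambda>t. integral {0..t} g - integral {t..0} g)"
  have "G 0 = 0" by (simp add: G_def)
  moreover have "(G has_vector_derivative g t) (at t)" for t
  proof -
  \<comment> \<open>A base point to the left of both 0 and \<open>t\<close>: near \<open>t\<close>,
    \<open>G\<close> is an ordinary integral from \<open>a\<close>, up to a constant.\<close>
  define a where "a = - \<bar>t\<bar> - 1"
  have int: "g integrable_on {c..d}" for c d
    using assms continuous_on_subset integrable_continuous_real by blast
  have eq: "G u = integral {a..u} g - integral {a..0} g" if "u > a" for u
  proof (cases "u \<ge> 0")
    case True
    have "integral {a..0} g + integral {0..u} g = integral {a..u} g"
      by (rule Henstock_Kurzweil_Integration.integral_combine[OF _ _ int]) (use True in \<open>auto simp: a_def\<close>)
    with True show ?thesis by (cases "u = 0") (simp_all add: G_def algebra_simps)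
  next
    case False
    have "integral {a..u} g + integral {u..0} g = integral {a..0} g"
      by (rule Henstock_Kurzweil_Integration.integral_combine[OF _ _ int]) (use False that in auto)
    with False show ?thesis by (simp add: G_def algebra_simps)
  qed
  have t: "t \<in> {a<..<\<bar>t\<bar> + 1}" by (auto simp: a_def)
  have "((\<lambda>u. integral {a..u} g) has_vector_derivative g t) (at t within {a..\<bar>t\<bar> + 1})"
    by (rule integral_has_vector_derivative) (use assms continuous_on_subset t in auto)
  hence "((\<lambda>u. integral {a..u} g) has_vector_derivative g t) (at t within {a<..<\<bar>t\<bar> + 1})"
    by (rule has_vector_derivative_within_subset) auto
  hence "((\<lambda>u. integral {a..u} g) has_vector_derivative g t) (at t)"
    using has_vector_derivative_within_open[OF t open_greaterThanLessThan] by metis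
  hence "((\<lambda>u. integral {a..u} g - integral {a..0} g) has_vector_derivative g t) (at t)"
    by (simp only: has_vector_derivative_diff_const)
  thus ?thesis
    by (rule has_vector_derivative_transform_within_open[where S = "{a<..<\<bar>t\<bar> + 1}"])
       (use t eq in auto)
  qed
  ultimately show ?thesis by blast
qed

text \<open>The right-hand side is the integral of the bound on \<open>g\<close> from 0 to
  \<open>\<bar>t\<bar>\<close>. The factor \<open>1 / K\<close> gained by integrating the
  exponential weight is what makes the Picard operator contract.\<close>

lemma exp_abs_antiderivative_bound:
  fixes G :: "real \<Rightarrow> 'a::real_normed_vector"
  assumes G: "\<And>t. (G has_vector_derivative g t) (at t)" and K: "K > 0"
    and g: "\<And>t. norm (g t) \<le> c * exp (K * \<bar>t\<bar>)"
  shows "norm (G t - G 0) \<le> c / K * (exp (K * \<bar>t\<bar>) - 1)"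
proof -
  have c: "continuous_on S G" for S
    using G by (meson continuous_at_imp_continuous_on has_vector_derivative_continuous)
  consider "t = 0" | "t > 0" | "t < 0" by linarith
  thus ?thesis
  proof cases
    case 2
    have "norm (G t - G 0) \<le> c / K * exp (K * t) - c / K * exp (K * 0)"
    proof (rule differentiable_bound_general[OF 2 c _ G])
      show "((\<lambda>s. c / K * exp (K * s)) has_vector_derivative c * exp (K * s)) (at s)" for s
        unfolding has_real_derivative_iff_has_vector_derivative[symmetric]
        by (auto intro!: derivative_eq_intros simp: K less_imp_neq[OF K, symmetric])
      show "norm (g s) \<le> c * exp (K * s)" if "0 < s" for s using g[of s] that by simp
    qed (use K in \<open>auto intro!: continuous_intros\<close>)
    thus ?thesis using 2 by (simp add: algebra_simps)
  next
    case 3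
    have "norm (G 0 - G t) \<le> - (c / K * exp (- K * 0)) - - (c / K * exp (- K * t))"
    proof (rule differentiable_bound_general[OF 3 c _ G])
      show "((\<lambda>s. - (c / K * exp (- K * s))) has_vector_derivative c * exp (- K * s)) (at s)" for s
        unfolding has_real_derivative_iff_has_vector_derivative[symmetric]
        by (auto intro!: derivative_eq_intros simp: K less_imp_neq[OF K, symmetric])
      show "norm (g s) \<le> c * exp (- K * s)" if "s < 0" for s using g[of s] that by simp
    qed (use K in \<open>auto intro!: continuous_intros\<close>)
    thus ?thesis using 3 by (simp add: algebra_simps norm_minus_commute)
  qed simp
qed

text \<open>Picard iteration on the whole line at once: in the supremum norm weighted by
  \<open>exp (- K * \<bar>t\<bar>)\<close> with \<open>K\<close> twice the Lipschitz constant, the integral operator is a contraction.\<close>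

lemma global_ode_solution:
  fixes f :: "real \<Rightarrow> 'a \<Rightarrow> 'a::banach"
  assumes cont: "continuous_on UNIV (\<lambda>(t, x). f t x)"
    and lip: "\<And>t x y. norm (f t x - f t y) \<le> L * norm (x - y)"
    and zero: "\<And>t. f t 0 = 0"
  obtains x where "x 0 = x0" "\<And>t. (x has_vector_derivative f t (x t)) (at t)"
proof -
  define M where "M = \<bar>L\<bar> + 1"
  define K where "K = 2 * M"
  have K: "K > 0" "M / K = 1 / 2" "M > 0" by (auto simp: K_def M_def)
  have lip': "norm (f t x - f t y) \<le> M * norm (x - y)" for t x y
    using lip[of t x y] by (smt (verit) M_def mult_right_mono norm_ge_zero)
  \<comment> \<open>The unknown \<phi> is the solution times
    \<open>exp (- K * \<bar>t\<bar>)\<close>, so that it lies in the Banach space of bounded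
    continuous functions. Here the weight is undone before \<open>f\<close> is applied.\<close>
  define g where "g = (\<lambda>\<phi> s. f s (exp (K * \<bar>s\<bar>) *\<^sub>R \<phi> s))"
  have g_cont: "continuous_on UNIV (g \<phi>)" if "continuous_on UNIV \<phi>" for \<phi>
  proof -
    have "continuous_on UNIV (\<lambda>s. (s, exp (K * \<bar>s\<bar>) *\<^sub>R \<phi> s))"
      by (intro continuous_intros that)
    from continuous_on_compose[OF this continuous_on_subset[OF cont]]
    show ?thesis by (simp add: g_def o_def)
  qed
  define I where "I = (\<lambda>\<phi>. SOME G. G 0 = 0 \<and> (\<forall>t. (G has_vector_derivative g \<phi> t) (at t)))"
  have I: "I \<phi> 0 = 0 \<and> (\<forall>t. (I \<phi> has_vector_derivative g \<phi> t) (at t))"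
    if \<phi>: "continuous_on UNIV \<phi>" for \<phi>
    unfolding I_def by (rule someI_ex[OF global_antiderivative[OF g_cont[OF \<phi>]]])
  define T where "T = (\<lambda>\<phi> t. exp (- K * \<bar>t\<bar>) *\<^sub>R (x0 + I \<phi> t))"
  have dist: "norm (T \<phi> t - T \<psi> t) \<le> c / 2"
    if \<phi>: "continuous_on UNIV \<phi>" and \<psi>: "continuous_on UNIV \<psi>"
      and c: "\<And>t. norm (\<phi> t - \<psi> t) \<le> c" for \<phi> \<psi> c t
  proof -
    have "norm ((I \<phi> t - I \<psi> t) - (I \<phi> 0 - I \<psi> 0)) \<le> (M * c) / K * (exp (K * \<bar>t\<bar>) - 1)"
    proof (rule exp_abs_antiderivative_bound)
      show "((\<lambda>t. I \<phi> t - I \<psi> t) has_vector_derivative (g \<phi> t - g \<psi> t)) (at t)" for t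
        using I \<phi> \<psi> by (intro has_vector_derivative_diff) auto
      show "norm (g \<phi> t - g \<psi> t) \<le> M * c * exp (K * \<bar>t\<bar>)" for t
      proof -
        have "norm (g \<phi> t - g \<psi> t) \<le> M * (exp (K * \<bar>t\<bar>) * norm (\<phi> t - \<psi> t))"
          unfolding g_def by (rule order_trans[OF lip']) (simp flip: scaleR_diff_right)
        also have "\<dots> \<le> M * (exp (K * \<bar>t\<bar>) * c)"
          using K(3) c by (intro mult_left_mono) auto
        finally show ?thesis by (simp add: ac_simps)
      qed
    qed (rule K)
    also have "\<dots> \<le> c / 2 * exp (K * \<bar>t\<bar>)"
      using K(2) order_trans[OF norm_ge_zero c] by (simp add: field_simps)
    finally have "norm (I \<phi> t - I \<psi> t) \<le> c / 2 * exp (K * \<bar>t\<bar>)"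
      using I \<phi> \<psi> by simp
    hence "exp (- K * \<bar>t\<bar>) * norm (I \<phi> t - I \<psi> t) \<le> c / 2"
      by (simp add: exp_minus field_simps)
    moreover have "T \<phi> t - T \<psi> t = exp (- K * \<bar>t\<bar>) *\<^sub>R (I \<phi> t - I \<psi> t)"
      by (simp add: T_def algebra_simps)
    ultimately show ?thesis by simp
  qed
  have T_cont: "continuous_on UNIV (T \<phi>)" if "continuous_on UNIV \<phi>" for \<phi>
  proof -
    have "continuous_on UNIV (I \<phi>)"
      using I[OF that] by (meson continuous_at_imp_continuous_on has_vector_derivative_continuous)
    thus ?thesis unfolding T_def by (intro continuous_intros)
  qed
  have T_bcont: "T \<phi> \<in> bcontfun" if b: "\<phi> \<in> bcontfun" for \<phi>
  proof -
    have \<phi>: "continuous_on UNIV \<phi>" using b by (simp add: bcontfun_def)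
    obtain c where c: "norm (\<phi> t) \<le> c" for t
      using b by (auto simp: bcontfun_def bounded_iff)
    have 0: "continuous_on UNIV (\<lambda>_::real. 0::'a)" by simp
    \<comment> \<open>The operator maps 0 to a bounded function because \<open>f t 0 = 0\<close>;
      \<open>dist\<close> then gives boundedness of the image of every bounded \<phi>.\<close>
    have "norm (T (\<lambda>_. 0) t) \<le> norm x0" for t
    proof -
      have "norm (I (\<lambda>_. 0) t - I (\<lambda>_. 0) 0) \<le> 0 / K * (exp (K * \<bar>t\<bar>) - 1)"
        using I[OF 0] by (intro exp_abs_antiderivative_bound[where g = "g (\<lambda>_. 0)"])
          (auto simp: K g_def zero)
      hence "I (\<lambda>_. 0) t = 0" using I[OF 0] by simp
      thus ?thesis using K by (simp add: T_def mult_left_le_one_le)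
    qed
    hence "norm (T \<phi> t) \<le> norm x0 + c / 2" for t
      using dist[OF \<phi> 0, of c t] c norm_triangle_sub[of "T \<phi> t" "T (\<lambda>_. 0) t"]
      by (smt (verit) diff_zero)
    thus ?thesis using T_cont[OF \<phi>] by (auto simp: bcontfun_def bounded_iff)
  qed
  define TT where "TT = (\<lambda>\<phi>. Bcontfun (T (apply_bcontfun \<phi>)))"
  have TT: "apply_bcontfun (TT \<phi>) = T (apply_bcontfun \<phi>)" for \<phi>
    unfolding TT_def by (rule Bcontfun_inverse[OF T_bcont[OF apply_bcontfun]])
  have "dist (TT \<phi>) (TT \<psi>) \<le> 1 / 2 * dist \<phi> \<psi>" for \<phi> \<psi>
  proof (rule dist_bound)
    fix t
    have "norm (T \<phi> t - T \<psi> t) \<le> dist \<phi> \<psi> / 2"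
      by (rule dist) (simp_all add: dist_bounded flip: dist_norm)
    thus "dist (TT \<phi> t) (TT \<psi> t) \<le> 1 / 2 * dist \<phi> \<psi>" by (simp add: TT dist_norm)
  qed
  then obtain \<phi> where "TT \<phi> = \<phi>"
    using banach_fix_type[of "1/2" TT] by auto
  hence fp: "T \<phi> t = \<phi> t" for t using TT[of \<phi>] by simp
  show ?thesis
  proof (rule that)
    define x where "x = (\<lambda>t. x0 + I (apply_bcontfun \<phi>) t)"
    have \<phi>: "continuous_on UNIV (apply_bcontfun \<phi>)" by simp
    show "x 0 = x0" using I[OF \<phi>] by (simp add: x_def)
    fix t
    have "exp (K * \<bar>t\<bar>) *\<^sub>R T \<phi> t = x t"
      unfolding T_def x_def by (simp add: exp_minus)
    hence "exp (K * \<bar>t\<bar>) *\<^sub>R \<phi> t = x t" by (simp only: fp)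
    hence "g \<phi> t = f t (x t)" by (simp add: g_def)
    moreover have "(I \<phi> has_vector_derivative g \<phi> t) (at t)" using I[OF \<phi>] by blast
    ultimately have "(I \<phi> has_vector_derivative f t (x t)) (at t)" by simp
    from has_vector_derivative_add[OF has_vector_derivative_const this]
    show "(x has_vector_derivative f t (x t)) (at t)" by (simp add: x_def)
  qed
qed

section \<open>Gronwall's inequality in both time directions\<close>

lemma gronwall_nonneg:
  fixes y :: "real \<Rightarrow> 'a::real_inner"
  assumes y: "\<And>t. t \<in> {0..T} \<Longrightarrow> (y has_vector_derivative y' t) (at t)"
    and b: "\<And>t. t \<in> {0..T} \<Longrightarrow> norm (y' t) \<le> L * norm (y t) + \<epsilon>"
    and T: "0 \<le> T" and L: "0 \<le> L" and e: "0 \<le> \<epsilon>"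
  shows "(norm (y T))\<^sup>2 \<le> ((norm (y 0))\<^sup>2 + \<epsilon>\<^sup>2) * exp ((2 * L + 1) * T)"
proof -
  \<comment> \<open>The square of the norm is used because the norm is not differentiable at 0. The
    extra 1 in \<open>k\<close> absorbs the inhomogeneity through
    \<open>2 * norm y * \<epsilon> \<le> (norm y)^2 + \<epsilon>^2\<close>.\<close>
  define k where "k = 2 * L + 1"
  define h where "h = (\<lambda>t. (y t \<bullet> y t + \<epsilon>\<^sup>2) * exp (- k * t))"
  have "h T \<le> h 0"
  proof (rule DERIV_nonpos_imp_nonincreasing[OF T])
    fix t assume "0 \<le> t" "t \<le> T"
    hence t: "t \<in> {0..T}" by simp
    have "((\<lambda>t. y t \<bullet> y t) has_vector_derivative (y t \<bullet> y' t + y' t \<bullet> y t)) (at t)"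
      by (rule bounded_bilinear.has_vector_derivative[OF bounded_bilinear_inner y[OF t] y[OF t]])
    hence d: "((\<lambda>t. y t \<bullet> y t) has_real_derivative (2 * (y t \<bullet> y' t))) (at t)"
      by (simp add: has_real_derivative_iff_has_vector_derivative inner_commute)
    have "(h has_real_derivative
        (2 * (y t \<bullet> y' t) - k * (y t \<bullet> y t + \<epsilon>\<^sup>2)) * exp (- k * t)) (at t)"
      unfolding h_def by (auto intro!: derivative_eq_intros d simp: algebra_simps)
    moreover have "2 * (y t \<bullet> y' t) \<le> k * (y t \<bullet> y t + \<epsilon>\<^sup>2)"
    proof -
      have "y t \<bullet> y' t \<le> norm (y t) * (L * norm (y t) + \<epsilon>)"
        by (rule order_trans[OF norm_cauchy_schwarz]) (simp add: b[OF t] mult_left_mono)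
      moreover have "2 * (norm (y t) * (L * norm (y t) + \<epsilon>)) \<le> k * ((norm (y t))\<^sup>2 + \<epsilon>\<^sup>2)"
      proof -
        have "0 \<le> (norm (y t) - \<epsilon>)\<^sup>2 + 2 * L * \<epsilon>\<^sup>2" using L by simp
        thus ?thesis by (simp add: k_def power2_eq_square algebra_simps)
      qed
      ultimately show ?thesis by (simp add: power2_norm_eq_inner)
    qed
    ultimately show "\<exists>z. (h has_real_derivative z) (at t) \<and> z \<le> 0"
      by (meson diff_le_0_iff_le exp_ge_zero mult_nonpos_nonneg)
  qed
  hence "(y T \<bullet> y T + \<epsilon>\<^sup>2) * exp (- k * T) \<le> y 0 \<bullet> y 0 + \<epsilon>\<^sup>2" by (simp add: h_def)
  hence "y T \<bullet> y T + \<epsilon>\<^sup>2 \<le> (y 0 \<bullet> y 0 + \<epsilon>\<^sup>2) * exp (k * T)"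
    by (simp add: exp_minus field_simps)
  hence "y T \<bullet> y T \<le> (y 0 \<bullet> y 0 + \<epsilon>\<^sup>2) * exp (k * T)"
    by (smt (verit) zero_le_power2)
  thus ?thesis by (simp add: power2_norm_eq_inner k_def)
qed

lemma gronwall:
  fixes y :: "real \<Rightarrow> 'a::real_inner"
  assumes y: "\<And>t. (y has_vector_derivative y' t) (at t)"
    and b: "\<And>t. \<bar>t\<bar> \<le> \<bar>T\<bar> \<Longrightarrow> norm (y' t) \<le> L * norm (y t) + \<epsilon>"
    and L: "0 \<le> L" and e: "0 \<le> \<epsilon>"
  shows "(norm (y T))\<^sup>2 \<le> ((norm (y 0))\<^sup>2 + \<epsilon>\<^sup>2) * exp ((2 * L + 1) * \<bar>T\<bar>)"
proof (cases "0 \<le> T")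
  case True
  thus ?thesis using gronwall_nonneg[of T y y' L \<epsilon>] y b L e by simp
next
  case False
  have "(norm (y (- (- T))))\<^sup>2 \<le> ((norm (y (- 0)))\<^sup>2 + \<epsilon>\<^sup>2) * exp ((2 * L + 1) * (- T))"
  proof (rule gronwall_nonneg)
    fix t
    have "((y \<circ> uminus) has_vector_derivative (- 1) *\<^sub>R y' (- t)) (at t)"
      by (rule vector_diff_chain_at) (auto intro!: derivative_eq_intros y)
    thus "((\<lambda>t. y (- t)) has_vector_derivative - y' (- t)) (at t)" by (simp add: o_def)
    show "norm (- y' (- t)) \<le> L * norm (y (- t)) + \<epsilon>" if "t \<in> {0..- T}"
      using b[of "- t"] that by simp
  qed (use False L e in auto)
  thus ?thesis using False by simp
qed

section \<open>Linear systems: existence, uniqueness and the fundamental matrix\<close>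

lemma linear_system_solution:
  fixes A :: "real \<Rightarrow> real^'n^'n"
  assumes "continuous_on UNIV (\<lambda>(t, z). A t *v z)"
    and "\<And>t z. norm (A t *v z) \<le> L * norm z"
  obtains z where "z 0 = z0" "\<And>t. (z has_vector_derivative A t *v z t) (at t)"
proof (rule global_ode_solution[of "\<lambda>t z. A t *v z" L z0])
  show "norm (A t *v x - A t *v y) \<le> L * norm (x - y)" for t x y
    using assms(2)[of t "x - y"] by (simp add: matrix_vector_mult_diff_distrib)
qed (use assms(1) that in auto)

lemma linear_system_unique:
  fixes A :: "real \<Rightarrow> real^'n^'n"
  assumes bound: "\<And>t z. norm (A t *v z) \<le> L * norm z" and L: "0 \<le> L"
    and y: "\<And>t. (y has_vector_derivative A t *v y t) (at t)"
    and z: "\<And>t. (z has_vector_derivative A t *v z t) (at t)"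
    and "y 0 = z 0"
  shows "y t = z t"
proof -
  have "(norm (y t - z t))\<^sup>2 \<le> ((norm (y 0 - z 0))\<^sup>2 + 0\<^sup>2) * exp ((2 * L + 1) * \<bar>t\<bar>)"
  proof (rule gronwall)
    show "((\<lambda>t. y t - z t) has_vector_derivative A t *v (y t - z t)) (at t)" for t
      using has_vector_derivative_diff[OF y z, of t] by (simp add: matrix_vector_mult_diff_distrib)
  qed (use bound L in auto)
  thus ?thesis using assms(5) by simp
qed

lemma bounded_linear_matrix_vector_left: "bounded_linear (\<lambda>M. (M :: real^'n^'m) *v v)"
  by (rule linear_conv_bounded_linear[THEN iffD1], rule linearI)
     (simp_all add: matrix_vector_mult_add_rdistrib scaleR_matrix_vector_assoc)

lemma fundamental_matrix_exists:
  fixes A :: "real \<Rightarrow> real^'n^'n"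
  assumes cont: "continuous_on UNIV (\<lambda>(t, z). A t *v z)"
    and bound: "\<And>t z. norm (A t *v z) \<le> L * norm z"
  shows "\<exists>\<gamma>. \<gamma> 0 = mat 1 \<and> (\<forall>t. (\<gamma> has_vector_derivative A t ** \<gamma> t) (at t))"
proof -
  have "\<exists>z. z 0 = axis j 1 \<and> (\<forall>t. (z has_vector_derivative A t *v z t) (at t))" for j
    using linear_system_solution[OF assms, of "axis j 1"] by metis
  then obtain z where z0: "z j 0 = axis j 1"
    and z: "(z j has_vector_derivative A t *v z j t) (at t)" for j t
    by metis
  \<comment> \<open>Writing the matrix as a sum of bounded linear images of its columns reduces its
    derivative to that of the vector solutions.\<close>
  define col :: "'n \<Rightarrow> real^'n \<Rightarrow> real^'n^'n" where "col = (\<lambda>j v. \<chi> i k. if k = j then v $ i else 0)"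
  have col: "bounded_linear (col j)" for j
    by (rule linear_conv_bounded_linear[THEN iffD1], rule linearI)
       (simp_all add: col_def vec_eq_iff)
  have sum_col: "(\<Sum>j\<in>UNIV. col j (v j)) $ i $ k = v k $ i" for v i k
    by (simp add: col_def)
  define \<gamma> where "\<gamma> = (\<lambda>t. \<Sum>j\<in>UNIV. col j (z j t))"
  have mult: "A t ** \<gamma> t = (\<Sum>j\<in>UNIV. col j (A t *v z j t))" for t
    unfolding \<gamma>_def vec_eq_iff sum_col matrix_matrix_mult_def
    by (simp only: vec_lambda_beta sum_col) (simp add: matrix_vector_mult_def)
  show ?thesis
  proof (intro exI[of _ \<gamma>] conjI allI)
    show "\<gamma> 0 = mat 1"
      unfolding \<gamma>_def vec_eq_iff sum_col z0 by (auto simp: axis_def mat_def)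
    show "(\<gamma> has_vector_derivative A t ** \<gamma> t) (at t)" for t
      unfolding mult unfolding \<gamma>_def
      by (intro has_vector_derivative_sum bounded_linear.has_vector_derivative[OF col] z)
  qed
qed

section \<open>Block form of the linearized systems\<close>

definition joined :: "real^'k \<Rightarrow> real^'k \<Rightarrow> real^('k+'k::finite)" where
  "joined p x = (\<chi> i. case i of Inl a \<Rightarrow> p $ a | Inr a \<Rightarrow> x $ a)"

definition upper :: "real^('k+'k::finite) \<Rightarrow> real^'k" where
  "upper z = (\<chi> a. z $ Inl a)"

definition lower :: "real^('k+'k::finite) \<Rightarrow> real^'k" where
  "lower z = (\<chi> a. z $ Inr a)"

lemma upper_joined [simp]: "upper (joined p x) = p"
  and lower_joined [simp]: "lower (joined p x) = x"
  and joined_upper_lower [simp]: "joined (upper z) (lower z) = z"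
  by (simp_all add: joined_def upper_def lower_def vec_eq_iff split: sum.split)

lemma joined_add: "joined (p + p') (x + x') = joined p x + joined p' x'"
  and joined_scaleR: "joined (c *\<^sub>R p) (c *\<^sub>R x) = c *\<^sub>R joined p x"
  by (simp_all add: joined_def vec_eq_iff split: sum.split)

lemma joined_zero [simp]: "joined 0 0 = 0"
  by (simp add: joined_def vec_eq_iff split: sum.split)

lemma sum_UNIV_plus:
  "(\<Sum>j\<in>UNIV. f j) = (\<Sum>a\<in>UNIV. f (Inl a)) + (\<Sum>b\<in>UNIV. f (Inr b))"
  for f :: "'a::finite + 'b::finite \<Rightarrow> 'c::comm_monoid_add"
  unfolding UNIV_Plus_UNIV[symmetric] by (subst sum.Plus) simp_all

lemma inner_joined: "joined p x \<bullet> joined p' x' = p \<bullet> p' + x \<bullet> x'"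
  by (simp add: inner_vec_def sum_UNIV_plus joined_def)

lemma norm_joined: "(norm (joined p x))\<^sup>2 = (norm p)\<^sup>2 + (norm x)\<^sup>2"
  by (simp add: power2_norm_eq_inner inner_joined)

lemma norm_joined_le: "norm (joined p x) \<le> norm p + norm x"
  by (rule power2_le_imp_le) (simp_all add: norm_joined power2_sum)

lemma norm_le_norm_joined: "norm p \<le> norm (joined p x)" "norm x \<le> norm (joined p x)"
  by (rule power2_le_imp_le; simp add: norm_joined)+

lemma bounded_linear_joined: "bounded_linear (\<lambda>z. joined (fst z) (snd z))"
  by (rule linear_conv_bounded_linear[THEN iffD1], rule linearI)
     (simp_all add: joined_add joined_scaleR)

lemma bounded_linear_upper: "bounded_linear upper"
  by (rule linear_conv_bounded_linear[THEN iffD1], rule linearI)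
     (simp_all add: upper_def vec_eq_iff)

lemma bounded_linear_lower: "bounded_linear lower"
  by (rule linear_conv_bounded_linear[THEN iffD1], rule linearI)
     (simp_all add: lower_def vec_eq_iff)

lemma has_vector_derivative_joined:
  assumes "(p has_vector_derivative p') (at t)" "(x has_vector_derivative x') (at t)"
  shows "((\<lambda>t. joined (p t) (x t)) has_vector_derivative joined p' x') (at t)"
  using bounded_linear.has_vector_derivative[OF bounded_linear_joined
      has_vector_derivative_Pair[OF assms]] by simp

lemma uminus_matrix_vector_mult: "(- M) *v x = - (M *v x)"
  for M :: "'a::comm_ring_1^'n^'m"
  by (simp add: matrix_vector_mult_def vec_eq_iff sum_negf)

lemma symp_J_block_mat_mult:
  "(symp_J ** block_mat A B C D) *v z =
     joined (- (C *v upper z + D *v lower z)) (A *v upper z + B *v lower z)"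
proof -
  have mult: "block_mat A B C D *v z =
      joined (A *v upper z + B *v lower z) (C *v upper z + D *v lower z)" for A B C D :: "real^'k^'k" and z
    by (simp add: matrix_vector_mult_def vec_eq_iff sum_UNIV_plus block_mat_def joined_def
      upper_def lower_def split: sum.split)
  show ?thesis
    unfolding symp_J_def matrix_vector_mul_assoc[symmetric] mult
    by (simp add: uminus_matrix_vector_mult)
qed

lemma JJ_nth:
  "(JJ *v v) $ 1 = - (v $ 2)" "(JJ *v v) $ 2 = v $ 1"
  "(JJ *v v) $ 3 = - (v $ 4)" "(JJ *v v) $ 4 = v $ 3"
  by (simp_all add: JJ_def matrix_vector_mult_def sum_4 vector_4_nth)

lemma inner_JJ: "v \<bullet> (JJ *v w) = - ((JJ *v v) \<bullet> w)"
  by (simp add: inner_vec_def sum_4 JJ_nth)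

lemma inner_JJ_self: "v \<bullet> (JJ *v v) = 0"
  by (simp add: inner_vec_def sum_4 JJ_nth)

lemma norm_JJ: "norm (JJ *v v) = norm v"
  by (simp add: norm_eq_sqrt_inner inner_vec_def sum_4 JJ_nth)

lemma matrix_vector_norm_bound:
  "\<exists>K\<ge>0. \<forall>x. norm ((M :: real^'n^'m) *v x) \<le> K * norm x"
  using bounded_linear.nonneg_bounded[OF matrix_vector_mul_bounded_linear[of M]]
  by (metis mult.commute)

section \<open>The two linearized systems in the coordinates \<open>(p, x)\<close>\<close>

definition ere_solution ::
    "real^4^4 \<Rightarrow> real \<Rightarrow> (real \<Rightarrow> real^4) \<Rightarrow> (real \<Rightarrow> real^4) \<Rightarrow> bool" where
  "ere_solution R e p x \<longleftrightarrow>
     (\<forall>t. (p has_vector_derivative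
             - (JJ *v p t) - x t + (1 / (1 + e * cos t)) *\<^sub>R (R *v x t)) (at t) \<and>
          (x has_vector_derivative p t - JJ *v x t) (at t))"

lemma ere_field:
  "(symp_J ** ere_B R e t) *v z = joined
     (- (JJ *v upper z) - lower z + (1 / (1 + e * cos t)) *\<^sub>R (R *v lower z))
     (upper z - JJ *v lower z)"
  by (simp add: ere_B_def symp_J_block_mat_mult uminus_matrix_vector_mult algebra_simps flip: scaleR_matrix_vector_assoc)

lemma coll_field:
  "(symp_J ** coll_B R \<tau>) *v z = joined
     (- (coll_Q \<tau> / 4) *\<^sub>R upper z - coll_q \<tau> *\<^sub>R (JJ *v upper z) - (coll_q \<tau>)\<^sup>2 *\<^sub>R lower z + R *v lower z)
     (upper z + (coll_Q \<tau> / 4) *\<^sub>R lower z - coll_q \<tau> *\<^sub>R (JJ *v lower z))"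
  by (simp add: coll_B_def symp_J_block_mat_mult algebra_simps flip: scaleR_matrix_vector_assoc)

lemma continuous_on_matrix_vector [continuous_intros]:
  "continuous_on S f \<Longrightarrow> continuous_on S (\<lambda>s. (M :: real^'n^'m) *v f s)"
  by (rule bounded_linear.continuous_on[OF matrix_vector_mul_bounded_linear])

lemma continuous_on_upper [continuous_intros]:
  "continuous_on S f \<Longrightarrow> continuous_on S (\<lambda>s. upper (f s))"
  by (rule bounded_linear.continuous_on[OF bounded_linear_upper])

lemma continuous_on_lower [continuous_intros]:
  "continuous_on S f \<Longrightarrow> continuous_on S (\<lambda>s. lower (f s))"
  by (rule bounded_linear.continuous_on[OF bounded_linear_lower])

lemma continuous_on_joined [continuous_intros]:
  "continuous_on S f \<Longrightarrow> continuous_on S g \<Longrightarrow> continuous_on S (\<lambda>s. joined (f s) (g s))"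
  using bounded_linear.continuous_on[OF bounded_linear_joined continuous_on_Pair] by fastforce

lemma kepler_denominator_pos: "0 \<le> e \<Longrightarrow> e < 1 \<Longrightarrow> 0 < 1 - (e::real) \<and> 1 - e \<le> 1 + e * cos t"
  using mult_left_mono[OF cos_ge_minus_one, of e t] by simp

lemma ere_field_continuous:
  assumes "0 \<le> e" "e < 1"
  shows "continuous_on UNIV (\<lambda>(t, z). (symp_J ** ere_B R e t) *v z)"
proof -
  have "1 + e * cos t \<noteq> 0" for t using kepler_denominator_pos[OF assms, of t] by linarith
  thus ?thesis unfolding ere_field case_prod_beta by (intro continuous_intros) auto
qed

lemma ere_field_bound:
  assumes "0 \<le> e" "e < 1"
  shows "\<exists>L\<ge>0. \<forall>t z. norm ((symp_J ** ere_B R e t) *v z) \<le> L * norm z"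
proof -
  obtain \<rho> where \<rho>: "\<rho> \<ge> 0" "\<And>x. norm (R *v x) \<le> \<rho> * norm x"
    using matrix_vector_norm_bound[of R] by blast
  define L where "L = 4 + \<rho> / (1 - e)"
  have "norm ((symp_J ** ere_B R e t) *v joined p x) \<le> L * norm (joined p x)" for t p x
  proof -
    have g: "0 < 1 - e" "1 - e \<le> 1 + e * cos t" using kepler_denominator_pos[OF assms] by auto
    have n: "norm p \<le> norm (joined p x)" "norm x \<le> norm (joined p x)"
      by (rule norm_le_norm_joined)+
    have "norm ((1 / (1 + e * cos t)) *\<^sub>R (R *v x)) \<le> 1 / (1 - e) * (\<rho> * norm (joined p x))"
      unfolding norm_scaleR
      by (rule mult_mono[OF _ order_trans[OF \<rho>(2)]])
         (use g n \<rho>(1) in \<open>auto simp: frac_le mult_left_mono\<close>)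
    moreover have "norm (- (JJ *v p) - x + y) \<le> norm p + norm x + norm y" for y
      by (metis norm_JJ norm_minus_cancel norm_triangle_ineq4 norm_triangle_mono order_refl)
    moreover have "norm (p - JJ *v x) \<le> norm p + norm x"
      by (metis norm_JJ norm_triangle_ineq4)
    ultimately have
      "norm (- (JJ *v p) - x + (1 / (1 + e * cos t)) *\<^sub>R (R *v x)) + norm (p - JJ *v x)
        \<le> 4 * norm (joined p x) + 1 / (1 - e) * (\<rho> * norm (joined p x))"
      using n by (smt (verit))
    also have "\<dots> = L * norm (joined p x)" by (simp add: L_def algebra_simps)
    finally show ?thesis
      unfolding ere_field upper_joined lower_joined by (rule order_trans[OF norm_joined_le])
  qed
  hence "norm ((symp_J ** ere_B R e t) *v z) \<le> L * norm z" for t z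
    by (metis joined_upper_lower)
  moreover have "0 \<le> L" using assms \<rho>(1) by (simp add: L_def)
  ultimately show ?thesis by blast
qed

lemma ere_solutionI:
  assumes "\<And>t. (z has_vector_derivative (symp_J ** ere_B R e t) *v z t) (at t)"
  shows "ere_solution R e (\<lambda>t. upper (z t)) (\<lambda>t. lower (z t))"
  unfolding ere_solution_def
  using bounded_linear.has_vector_derivative[OF bounded_linear_upper assms]
    bounded_linear.has_vector_derivative[OF bounded_linear_lower assms]
  by (simp add: ere_field)

section \<open>Eigenvalues on the unit circle\<close>

text \<open>\<open>a\<close> and \<open>b\<close> are the real and imaginary parts of an
  eigenvector, which may be multiplied by a positive real number to normalize it.\<close>

lemma unit_eigenvalue_real_pair:
  fixes M :: "real^'n^'n"
  assumes "complex_eigenvalue M \<mu>"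
  obtains a b where "(norm a)\<^sup>2 + (norm b)\<^sup>2 = 1"
    "M *v a = Re \<mu> *\<^sub>R a - Im \<mu> *\<^sub>R b" "M *v b = Im \<mu> *\<^sub>R a + Re \<mu> *\<^sub>R b"
proof -
  obtain v where v: "v \<noteq> 0" "map_matrix complex_of_real M *v v = \<mu> *s v"
    using assms by (auto simp: complex_eigenvalue_def)
  define a where "a = (\<chi> i. Re (v $ i))"
  define b where "b = (\<chi> i. Im (v $ i))"
  have entry: "(\<Sum>j\<in>UNIV. complex_of_real (M $ i $ j) * v $ j) = \<mu> * v $ i" for i
    using v(2) by (simp add: vec_eq_iff matrix_vector_mult_def map_matrix_def)
  have M: "M *v a = Re \<mu> *\<^sub>R a - Im \<mu> *\<^sub>R b" "M *v b = Im \<mu> *\<^sub>R a + Re \<mu> *\<^sub>R b"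
    using arg_cong[OF entry, of Re] arg_cong[OF entry, of Im]
    by (simp_all add: vec_eq_iff matrix_vector_mult_def a_def b_def algebra_simps)
  have "a \<noteq> 0 \<or> b \<noteq> 0"
    using v(1) by (auto simp: vec_eq_iff a_def b_def complex_eq_iff)
  hence pos: "(norm a)\<^sup>2 + (norm b)\<^sup>2 > 0" by (auto simp: add_pos_nonneg add_nonneg_pos)
  define r where "r = inverse (sqrt ((norm a)\<^sup>2 + (norm b)\<^sup>2))"
  have r: "r\<^sup>2 = inverse ((norm a)\<^sup>2 + (norm b)\<^sup>2)"
    unfolding r_def power_inverse using pos by (subst real_sqrt_pow2) auto
  show ?thesis
  proof (rule that)
    show "(norm (r *\<^sub>R a))\<^sup>2 + (norm (r *\<^sub>R b))\<^sup>2 = 1"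
      unfolding norm_scaleR power_mult_distrib power2_abs r distrib_left[symmetric]
      by (rule left_inverse) (use pos in linarith)
  qed (simp_all add: matrix_vector_mult_scaleR M algebra_simps)
qed

text \<open>The real and imaginary parts of a complex solution that is multiplied by the unimodular
  number \<open>\<alpha> + i \<beta>\<close> over one period. The normalization is at
  \<open>t = 0\<close>, far from the singular time \<open>pi\<close>.\<close>

definition floquet_pair ::
    "real^4^4 \<Rightarrow> real \<Rightarrow> (real \<Rightarrow> real^4) \<Rightarrow> (real \<Rightarrow> real^4) \<Rightarrow> (real \<Rightarrow> real^4) \<Rightarrow> (real \<Rightarrow> real^4) \<Rightarrow> bool"
  where
  "floquet_pair R e p x p' x' \<longleftrightarrow>
     ere_solution R e p x \<and> ere_solution R e p' x' \<and>
     (norm (p 0))\<^sup>2 + (norm (x 0))\<^sup>2 + (norm (p' 0))\<^sup>2 + (norm (x' 0))\<^sup>2 = 1 \<and>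
     (\<exists>\<alpha> \<beta>. \<alpha>\<^sup>2 + \<beta>\<^sup>2 = 1 \<and>
        (\<forall>t. p (t + 2 * pi) = \<alpha> *\<^sub>R p t - \<beta> *\<^sub>R p' t \<and> p' (t + 2 * pi) = \<beta> *\<^sub>R p t + \<alpha> *\<^sub>R p' t \<and>
             x (t + 2 * pi) = \<alpha> *\<^sub>R x t - \<beta> *\<^sub>R x' t \<and> x' (t + 2 * pi) = \<beta> *\<^sub>R x t + \<alpha> *\<^sub>R x' t))"

lemma not_hyperbolic_floquet_pair:
  assumes e: "0 \<le> e" "e < 1" and "\<not> ere_hyperbolic R e"
  obtains p x p' x' where "floquet_pair R e p x p' x'"
proof -
  define A where "A = (\<lambda>t. symp_J ** ere_B R e t)"
  have A_per: "A (t + 2 * pi) = A t" for t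
    by (simp add: A_def ere_B_def)
  obtain L where L: "0 \<le> L" "\<And>t z. norm (A t *v z) \<le> L * norm z"
    unfolding A_def using ere_field_bound[OF e, of R] by blast
  obtain \<gamma> where \<gamma>: "\<gamma> 0 = mat 1" "\<And>t. (\<gamma> has_vector_derivative A t ** \<gamma> t) (at t)"
    using fundamental_matrix_exists[of A L] ere_field_continuous[OF e, of R] L(2) A_def by blast
  hence "ere_fundamental_solution R e \<gamma>"
    by (simp add: ere_fundamental_solution_def A_def)
  then obtain \<mu> where \<mu>: "complex_eigenvalue (\<gamma> (2 * pi)) \<mu>" "cmod \<mu> = 1"
    using assms(3) by (auto simp: ere_hyperbolic_def)
  obtain a b where ab: "(norm a)\<^sup>2 + (norm b)\<^sup>2 = 1"
    "\<gamma> (2 * pi) *v a = Re \<mu> *\<^sub>R a - Im \<mu> *\<^sub>R b" "\<gamma> (2 * pi) *v b = Im \<mu> *\<^sub>R a + Re \<mu> *\<^sub>R b"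
    by (rule unit_eigenvalue_real_pair[OF \<mu>(1)])
  have sol: "((\<lambda>t. \<gamma> t *v v) has_vector_derivative A t *v (\<gamma> t *v v)) (at t)" for v t
    using bounded_linear.has_vector_derivative[OF bounded_linear_matrix_vector_left \<gamma>(2)]
    by (simp add: matrix_vector_mul_assoc)
  \<comment> \<open>Both sides solve the same system, by periodicity of \<open>A\<close>, and they
    agree at time 0.\<close>
  have shift: "\<gamma> (t + 2 * pi) *v v = c *\<^sub>R (\<gamma> t *v a) + d *\<^sub>R (\<gamma> t *v b)"
    if "\<gamma> (2 * pi) *v v = c *\<^sub>R a + d *\<^sub>R b" for t v c d
  proof (rule linear_system_unique[OF L(2,1)])
    fix t
    have "((\<lambda>t. \<gamma> t *v v) \<circ> (\<lambda>t. t + 2 * pi) has_vector_derivative 1 *\<^sub>R (A t *v (\<gamma> (t + 2 * pi) *v v))) (at t)"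
      unfolding A_per[of t, symmetric]
      by (rule vector_diff_chain_at[OF _ sol]) (auto intro!: derivative_eq_intros)
    thus "((\<lambda>t. \<gamma> (t + 2 * pi) *v v) has_vector_derivative A t *v (\<gamma> (t + 2 * pi) *v v)) (at t)"
      by (simp add: o_def)
    have "((\<lambda>t. c *\<^sub>R (\<gamma> t *v a) + d *\<^sub>R (\<gamma> t *v b)) has_vector_derivative
        c *\<^sub>R (A t *v (\<gamma> t *v a)) + d *\<^sub>R (A t *v (\<gamma> t *v b))) (at t)"
      by (intro has_vector_derivative_add bounded_linear.has_vector_derivative[OF bounded_linear_scaleR_right] sol)
    thus "((\<lambda>t. c *\<^sub>R (\<gamma> t *v a) + d *\<^sub>R (\<gamma> t *v b)) has_vector_derivative
        A t *v (c *\<^sub>R (\<gamma> t *v a) + d *\<^sub>R (\<gamma> t *v b))) (at t)"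
      by (simp add: matrix_vector_right_distrib matrix_vector_mult_scaleR)
  qed (use that \<gamma>(1) in simp)
  have shift_a: "\<gamma> (t + 2 * pi) *v a = Re \<mu> *\<^sub>R (\<gamma> t *v a) - Im \<mu> *\<^sub>R (\<gamma> t *v b)" for t
    using shift[of a "Re \<mu>" "- Im \<mu>"] ab(2) by simp
  have shift_b: "\<gamma> (t + 2 * pi) *v b = Im \<mu> *\<^sub>R (\<gamma> t *v a) + Re \<mu> *\<^sub>R (\<gamma> t *v b)" for t
    using shift[of b "Im \<mu>" "Re \<mu>"] ab(3) by simp
  note lin = bounded_linear.linear[OF bounded_linear_upper] bounded_linear.linear[OF bounded_linear_lower]
  show ?thesis
  proof (rule that)
    show "floquet_pair R e (\<lambda>t. upper (\<gamma> t *v a)) (\<lambda>t. lower (\<gamma> t *v a))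
        (\<lambda>t. upper (\<gamma> t *v b)) (\<lambda>t. lower (\<gamma> t *v b))"
      unfolding floquet_pair_def
    proof (intro conjI exI allI)
      have n: "(norm (upper v))\<^sup>2 + (norm (lower v))\<^sup>2 = (norm v)\<^sup>2" for v :: "real^(4+4)"
        using norm_joined[of "upper v" "lower v"] by simp
      show "(norm (upper (\<gamma> 0 *v a)))\<^sup>2 + (norm (lower (\<gamma> 0 *v a)))\<^sup>2 +
          (norm (upper (\<gamma> 0 *v b)))\<^sup>2 + (norm (lower (\<gamma> 0 *v b)))\<^sup>2 = 1"
        using ab(1) n[of a] n[of b] by (simp add: \<gamma>(1))
      show "(Re \<mu>)\<^sup>2 + (Im \<mu>)\<^sup>2 = 1" using \<mu>(2) by (simp add: cmod_def)
    qed (simp_all add: shift_a shift_b ere_solutionI[OF sol[unfolded A_def]]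
        linear_diff[OF lin(1)] linear_diff[OF lin(2)] linear_add[OF lin(1)] linear_add[OF lin(2)]
        linear_cmul[OF lin(1)] linear_cmul[OF lin(2)])
  qed
qed

section \<open>Positive definiteness of the Hessian\<close>

lemma binary_form_coercive:
  fixes \<alpha> \<beta> b :: real
  assumes "\<alpha> > 0" "\<beta> > 0" "b\<^sup>2 < \<alpha> * \<beta>"
  shows "\<exists>\<delta>>0. \<forall>s t. \<delta> * (s\<^sup>2 + t\<^sup>2) \<le> \<alpha> * s\<^sup>2 + \<beta> * t\<^sup>2 - 2 * b * s * t"
proof -
  \<comment> \<open>Determinant over trace is a lower bound for the smaller eigenvalue, since the
    larger one is at most the trace.\<close>
  define \<delta> where "\<delta> = (\<alpha> * \<beta> - b\<^sup>2) / (\<alpha> + \<beta>)"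
  have d: "\<delta> * (\<alpha> + \<beta>) = \<alpha> * \<beta> - b\<^sup>2" using assms by (simp add: \<delta>_def)
  have pos: "\<alpha> - \<delta> > 0"
  proof -
    have "(\<alpha> - \<delta>) * (\<alpha> + \<beta>) = \<alpha>\<^sup>2 + b\<^sup>2"
      using d by (simp add: algebra_simps power2_eq_square)
    moreover have "\<alpha>\<^sup>2 + b\<^sup>2 > 0" using assms by (simp add: add_pos_nonneg)
    ultimately show ?thesis using assms by (metis add_pos_pos zero_less_mult_pos2)
  qed
  have "\<delta> * (s\<^sup>2 + t\<^sup>2) \<le> \<alpha> * s\<^sup>2 + \<beta> * t\<^sup>2 - 2 * b * s * t" for s t
  proof -
    \<comment> \<open>Completing the square: with \<delta> subtracted from both diagonal entries,
      the determinant becomes \<open>\<delta>^2\<close>.\<close>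
    have "(\<alpha> - \<delta>) * (\<alpha> * s\<^sup>2 + \<beta> * t\<^sup>2 - 2 * b * s * t - \<delta> * (s\<^sup>2 + t\<^sup>2)) =
        ((\<alpha> - \<delta>) * s - b * t)\<^sup>2 + ((\<alpha> * \<beta> - b\<^sup>2) - \<delta> * (\<alpha> + \<beta>) + \<delta>\<^sup>2) * t\<^sup>2"
      by (simp add: algebra_simps power2_eq_square)
    also have "\<dots> = ((\<alpha> - \<delta>) * s - b * t)\<^sup>2 + (\<delta> * t)\<^sup>2"
      unfolding d by (simp add: power_mult_distrib)
    also have "\<dots> \<ge> 0" by simp
    finally show ?thesis using pos by (simp add: zero_le_mult_iff)
  qed
  moreover have "\<delta> > 0" using assms by (simp add: \<delta>_def)
  ultimately show ?thesis by blast
qed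

text \<open>The pairs \<open>(x1, x3)\<close> and \<open>(x2, - x4)\<close> decouple, and the sign
  in front of \<open>x4\<close> makes the two binary forms identical, so that one determinant
  decides.\<close>

lemma D_13gon_form:
  "x \<bullet> (D_13gon mc *v x) = (1/2 * (x $ 1)\<^sup>2 + c_coef mc * (x $ 3)\<^sup>2 - 2 * b_coef mc * (x $ 1) * (x $ 3))
     + (1/2 * (x $ 2)\<^sup>2 + c_coef mc * (- (x $ 4))\<^sup>2 - 2 * b_coef mc * (x $ 2) * (- (x $ 4)))"
  by (simp add: D_13gon_def inner_vec_def matrix_vector_mult_def sum_4 vector_4_nth
      power2_eq_square algebra_simps)

text \<open>The shift \<open>s\<close> treats both thresholds at once: \<open>s = 0\<close> asks
  that \<open>D\<close> be positive definite, \<open>s = 1\<close> that \<open>R = 1 + D\<close>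
  be.\<close>

lemma R_13gon_form_coercive:
  assumes "s \<ge> 0" "mc \<ge> 0" "(b_coef mc)\<^sup>2 < (s + 1/2) * (s + c_coef mc)"
  shows "\<exists>\<delta>>0. \<forall>x. (1 - s + \<delta>) * (x \<bullet> x) \<le> x \<bullet> (R_13gon mc *v x)"
proof -
  have "c_coef mc \<ge> 0" using assms(2) by (simp add: c_coef_def)
  moreover have "s + c_coef mc \<noteq> 0" using assms(3) by (metis mult_zero_right not_less zero_le_power2)
  ultimately have "s + 1/2 > 0" "s + c_coef mc > 0" using assms(1) by linarith+
  then obtain \<delta> where \<delta>: "\<delta> > 0"
    "\<And>y z. \<delta> * (y\<^sup>2 + z\<^sup>2) \<le> (s + 1/2) * y\<^sup>2 + (s + c_coef mc) * z\<^sup>2 - 2 * b_coef mc * y * z"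
    using binary_form_coercive[OF _ _ assms(3)] by blast
  have "(1 - s + \<delta>) * (x \<bullet> x) \<le> x \<bullet> (R_13gon mc *v x)" for x
  proof -
    have "x \<bullet> (R_13gon mc *v x) = x \<bullet> x + x \<bullet> (D_13gon mc *v x)"
      by (simp add: R_13gon_def matrix_vector_mult_add_rdistrib inner_add_right)
    moreover have "x \<bullet> x = (x $ 1)\<^sup>2 + (x $ 3)\<^sup>2 + ((x $ 2)\<^sup>2 + (- (x $ 4))\<^sup>2)"
      by (simp add: inner_vec_def sum_4 power2_eq_square)
    ultimately show ?thesis
      using \<delta>(2)[of "x $ 1" "x $ 3"] \<delta>(2)[of "x $ 2" "- (x $ 4)"]
      unfolding D_13gon_form by (simp add: algebra_simps)
  qed
  thus ?thesis using \<delta>(1) by blast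
qed

text \<open>Over the common denominator \<open>4 * (1 + sqrt 3 * mc)^2\<close>, the first difference
  has numerator \<open>(3 + mc) * (sqrt 3 - 24 * mc)\<close>. In the second the terms in
  \<open>mc^2\<close> cancel, and the zero of the remaining linear numerator is
  \<open>(6 + 9 * sqrt 3) / (54 - 15 * sqrt 3)\<close>, which rationalizes to the stated
  bound.\<close>

lemma b_coef_less:
  assumes "mc \<ge> 0"
  shows "mc < sqrt 3 / 24 \<Longrightarrow> (b_coef mc)\<^sup>2 < (0 + 1/2) * (0 + c_coef mc)"
    and "mc < (81 + 64 * sqrt 3) / 249 \<Longrightarrow> (b_coef mc)\<^sup>2 < (1 + 1/2) * (1 + c_coef mc)"
proof -
  define r where "r = sqrt (3::real)"
  have r: "r * r = 3" "r > 0" "r < 2"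
    by (simp_all add: r_def real_less_lsqrt)
  define w where "w = 1 + r * mc"
  have w: "w > 0" using assms r by (simp add: w_def add_pos_nonneg)
  define d where "d = 4 * w\<^sup>2"
  have d: "d > 0" using w by (simp add: d_def)
  have b: "(b_coef mc)\<^sup>2 = 27 * mc * (3 + mc) / d"
    unfolding b_coef_def d_def w_def r_def power_divide power_mult_distrib using assms by simp
  have c: "c_coef mc = 2 * r * (3 + mc) * w / d"
    using w by (simp add: c_coef_def d_def w_def[symmetric] r_def[symmetric] power2_eq_square)
  have rr: "r * (r * u) = 3 * u" for u using r(1) by (metis mult.assoc)
  show "(b_coef mc)\<^sup>2 < (0 + 1/2) * (0 + c_coef mc)" if "mc < sqrt 3 / 24"
  proof -
    have "(0 + 1/2) * (0 + c_coef mc) - (b_coef mc)\<^sup>2 =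
        (r * (3 + mc) * w - 27 * mc * (3 + mc)) / d"
      unfolding b c by (simp add: diff_divide_distrib)
    also have "r * (3 + mc) * w - 27 * mc * (3 + mc) = (3 + mc) * (r - 24 * mc)"
      by (simp add: w_def algebra_simps rr r(1))
    also have "(3 + mc) * (r - 24 * mc) / d > 0"
      using that assms d by (simp add: r_def)
    finally show ?thesis by simp
  qed
  show "(b_coef mc)\<^sup>2 < (1 + 1/2) * (1 + c_coef mc)" if "mc < (81 + 64 * sqrt 3) / 249"
  proof -
    have "(1 + 1/2) * (1 + c_coef mc) - (b_coef mc)\<^sup>2 =
        (3/2 * d + 3 * r * (3 + mc) * w - 27 * mc * (3 + mc)) / d"
      unfolding b c using d by (simp add: field_simps)
    also have "3/2 * d + 3 * r * (3 + mc) * w - 27 * mc * (3 + mc) = 6 + 9 * r - (54 - 15 * r) * mc"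
      by (simp add: d_def w_def algebra_simps power2_eq_square rr r(1))
    finally have eq: "(1 + 1/2) * (1 + c_coef mc) - (b_coef mc)\<^sup>2 =
        (6 + 9 * r - (54 - 15 * r) * mc) / d" .
    have "(54 - 15 * r) * mc < (54 - 15 * r) * ((81 + 64 * r) / 249)"
      using that r by (intro mult_strict_left_mono) (auto simp: r_def)
    also have "\<dots> = 6 + 9 * r" by (simp add: algebra_simps rr r(1))
    finally have "(6 + 9 * r - (54 - 15 * r) * mc) / d > 0" using d by simp
    thus ?thesis unfolding eq[symmetric] by simp
  qed
qed

section \<open>Hyperbolicity for all eccentricities\<close>

lemma inner_has_real_derivative:
  fixes f g :: "real \<Rightarrow> 'a::real_inner"
  assumes "(f has_vector_derivative f') (at t)" "(g has_vector_derivative g') (at t)"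
  shows "((\<lambda>t. f t \<bullet> g t) has_real_derivative f t \<bullet> g' + f' \<bullet> g t) (at t)"
  unfolding has_real_derivative_iff_has_vector_derivative
  by (rule bounded_bilinear.has_vector_derivative[OF bounded_bilinear_inner assms])

text \<open>Since \<open>JJ\<close> is skew-symmetric, the rotation terms cancel in all three inner
  products.\<close>

lemma ere_solution_inner_derivatives:
  assumes "ere_solution R e p x"
  shows "((\<lambda>t. x t \<bullet> x t) has_real_derivative 2 * (p t \<bullet> x t)) (at t)"
    and "((\<lambda>t. p t \<bullet> x t) has_real_derivative
           p t \<bullet> p t - x t \<bullet> x t + (x t \<bullet> (R *v x t)) / (1 + e * cos t)) (at t)"
    and "((\<lambda>t. p t \<bullet> p t) has_real_derivative
           2 * ((p t \<bullet> (R *v x t)) / (1 + e * cos t) - p t \<bullet> x t)) (at t)"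
proof -
  note d = assms[unfolded ere_solution_def, rule_format, of t]
  show "((\<lambda>t. x t \<bullet> x t) has_real_derivative 2 * (p t \<bullet> x t)) (at t)"
    using inner_has_real_derivative[OF d[THEN conjunct2] d[THEN conjunct2]]
    by (simp add: inner_diff_left inner_diff_right inner_JJ_self inner_commute[of _ "x t"])
  show "((\<lambda>t. p t \<bullet> x t) has_real_derivative
      p t \<bullet> p t - x t \<bullet> x t + (x t \<bullet> (R *v x t)) / (1 + e * cos t)) (at t)"
    using inner_has_real_derivative[OF d[THEN conjunct1] d[THEN conjunct2]]
    by (simp add: inner_diff_left inner_diff_right inner_add_left inner_JJ
      inner_commute[of "R *v x t"] algebra_simps)
  show "((\<lambda>t. p t \<bullet> p t) has_real_derivative
      2 * ((p t \<bullet> (R *v x t)) / (1 + e * cos t) - p t \<bullet> x t)) (at t)"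
    using inner_has_real_derivative[OF d[THEN conjunct1] d[THEN conjunct1]]
    by (simp add: inner_diff_left inner_diff_right inner_add_left inner_add_right inner_JJ_self
      inner_commute[of _ "p t"])
qed

text \<open>\<open>1 + e * cos t\<close> solves the scalar equation for \<open>R = 1\<close> in the inertial frame. The form below
  is \<open>y' \<bullet> y\<close>, for the solution \<open>y\<close> in that frame, corrected by the logarithmic derivative
  of \<open>1 + e * cos t\<close>, and therefore its derivative is nonnegative as soon as \<open>R \<ge> 1\<close>.\<close>

lemma kepler_form_derivative:
  assumes "0 \<le> e" "e < 1" "ere_solution R e p x"
  defines "h \<equiv> \<lambda>t. e * sin t / (1 + e * cos t)"
  shows "((\<lambda>t. p t \<bullet> x t + h t * (x t \<bullet> x t)) has_real_derivative
    (norm (p t + h t *\<^sub>R x t))\<^sup>2 + (x t \<bullet> (R *v x t) - x t \<bullet> x t) / (1 + e * cos t)) (at t)"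
proof -
  define g where "g = 1 + e * cos t"
  have g: "g > 0" using kepler_denominator_pos[OF assms(1,2), of t] by (simp add: g_def)
  have "(h has_real_derivative ((e * cos t) * g + (e * sin t)\<^sup>2) / g\<^sup>2) (at t)"
    unfolding h_def g_def using g[unfolded g_def]
    by (auto intro!: derivative_eq_intros simp: power2_eq_square)
  \<comment> \<open>With \<open>h = - g' / g\<close> and \<open>g'' = 1 - g\<close> this is a
    Riccati equation. Its term \<open>h^2\<close> completes the square in \<open>p + h x\<close>,
    and its remainder \<open>1 - 1 / g\<close> replaces \<open>R\<close> by
    \<open>R - 1\<close>.\<close>
  moreover have "((e * cos t) * g + (e * sin t)\<^sup>2) / g\<^sup>2 = (h t)\<^sup>2 + 1 - 1 / g"
    using g unfolding h_def g_def[symmetric]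
    by (simp add: divide_simps power2_eq_square) (simp add: g_def algebra_simps)
  ultimately have dh: "(h has_real_derivative (h t)\<^sup>2 + 1 - 1 / g) (at t)" by simp
  have "(norm (p t + h t *\<^sub>R x t))\<^sup>2 =
      p t \<bullet> p t + 2 * h t * (p t \<bullet> x t) + (h t)\<^sup>2 * (x t \<bullet> x t)"
    unfolding power2_norm_eq_inner
    by (simp add: inner_add_left inner_add_right inner_commute power2_eq_square algebra_simps)
  thus ?thesis
    using DERIV_add[OF ere_solution_inner_derivatives(2)[OF assms(3)]
      DERIV_mult[OF dh ere_solution_inner_derivatives(1)[OF assms(3)]]]
    by (simp add: g_def[symmetric] algebra_simps diff_divide_distrib)
qed

text \<open>Strict increase at the single time 0, where the normalized pair is nonzero, is enough:
  the form is nondecreasing afterwards, yet its sum over the pair returns to the initial value at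
  \<open>2 * pi\<close>.\<close>

lemma hyperbolic_of_form_ge:
  assumes e: "0 \<le> e" "e < 1" and \<delta>: "\<delta> > 0"
    and R: "\<And>x. (1 + \<delta>) * (x \<bullet> x) \<le> x \<bullet> (R *v x)"
  shows "ere_hyperbolic R e"
proof (rule ccontr)
  assume "\<not> ere_hyperbolic R e"
  then obtain p x p' x' where F: "floquet_pair R e p x p' x'"
    using not_hyperbolic_floquet_pair[OF e] by metis
  then obtain \<alpha> \<beta> where s: "ere_solution R e p x" "ere_solution R e p' x'"
    "(norm (p 0))\<^sup>2 + (norm (x 0))\<^sup>2 + (norm (p' 0))\<^sup>2 + (norm (x' 0))\<^sup>2 = 1" "\<alpha>\<^sup>2 + \<beta>\<^sup>2 = 1"
    and per: "p (t + 2 * pi) = \<alpha> *\<^sub>R p t - \<beta> *\<^sub>R p' t" "p' (t + 2 * pi) = \<beta> *\<^sub>R p t + \<alpha> *\<^sub>R p' t"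
      "x (t + 2 * pi) = \<alpha> *\<^sub>R x t - \<beta> *\<^sub>R x' t" "x' (t + 2 * pi) = \<beta> *\<^sub>R x t + \<alpha> *\<^sub>R x' t" for t
    unfolding floquet_pair_def by metis
  define h where "h = (\<lambda>t. e * sin t / (1 + e * cos t))"
  define f where "f = (\<lambda>(p::real\<Rightarrow>real^4) x t. p t \<bullet> x t + h t * (x t \<bullet> x t))"
  define f' where "f' = (\<lambda>(p::real\<Rightarrow>real^4) x t. (norm (p t + h t *\<^sub>R x t))\<^sup>2 +
      (x t \<bullet> (R *v x t) - x t \<bullet> x t) / (1 + e * cos t))"
  have d: "(f p x has_real_derivative f' p x t) (at t)" if "ere_solution R e p x" for p x t
    using kepler_form_derivative[OF e that] unfolding f_def f'_def h_def .
  have form: "\<delta> * (v \<bullet> v) \<le> v \<bullet> (R *v v) - v \<bullet> v" for v using R[of v] by (simp add: algebra_simps)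
  have g: "1 + e * cos t > 0" for t using kepler_denominator_pos[OF e, of t] by simp
  have lower: "(norm (p t + h t *\<^sub>R x t))\<^sup>2 + \<delta> * (x t \<bullet> x t) / (1 + e * cos t) \<le> f' p x t" for p x t
    unfolding f'_def using form g[of t] by (simp add: divide_right_mono)
  have nonneg: "f' p x t \<ge> 0" for p x t
    by (rule order_trans[OF _ lower]) (use \<delta> g[of t] in simp)
  define F where "F = (\<lambda>t. f p x t + f p' x' t)"
  have dF: "(F has_real_derivative f' p x t + f' p' x' t) (at t)" for t
    unfolding F_def by (intro DERIV_add d s)
  have per0: "p (2 * pi) = \<alpha> *\<^sub>R p 0 - \<beta> *\<^sub>R p' 0" "p' (2 * pi) = \<beta> *\<^sub>R p 0 + \<alpha> *\<^sub>R p' 0"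
    "x (2 * pi) = \<alpha> *\<^sub>R x 0 - \<beta> *\<^sub>R x' 0" "x' (2 * pi) = \<beta> *\<^sub>R x 0 + \<alpha> *\<^sub>R x' 0"
    using per[of 0] by simp_all
  have "F (2 * pi) = (\<alpha>\<^sup>2 + \<beta>\<^sup>2) * F 0"
    unfolding F_def f_def h_def per0
    by (simp add: inner_add_left inner_add_right inner_diff_left inner_diff_right inner_commute
      power2_eq_square algebra_simps)
  hence period: "F (2 * pi) = F 0" by (simp add: s)
  have zero: "p 0 = 0 \<and> x 0 = 0" if "f' p x 0 = 0" for p x
  proof -
    have "(norm (p 0))\<^sup>2 + \<delta> * (x 0 \<bullet> x 0) / (1 + e) \<le> 0"
      using lower[of p 0 x] that by (simp add: h_def)
    moreover have "\<delta> * (x 0 \<bullet> x 0) / (1 + e) \<ge> 0" using \<delta> e by simp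
    ultimately have "(norm (p 0))\<^sup>2 = 0" "\<delta> * (x 0 \<bullet> x 0) / (1 + e) = 0"
      using zero_le_power2[of "norm (p 0)"] by linarith+
    thus ?thesis using \<delta> e by simp
  qed
  have "f' p x 0 + f' p' x' 0 > 0"
  proof (rule ccontr)
    assume "\<not> ?thesis"
    hence "f' p x 0 = 0" "f' p' x' 0 = 0" using nonneg[of p x 0] nonneg[of p' x' 0] by linarith+
    hence "p 0 = 0 \<and> x 0 = 0 \<and> p' 0 = 0 \<and> x' 0 = 0"
      using zero[of p x] zero[of p' x'] by blast
    thus False using s(3) by simp
  qed
  then obtain \<epsilon> where \<epsilon>: "\<epsilon> > 0" "\<And>k. 0 < k \<Longrightarrow> k < \<epsilon> \<Longrightarrow> F 0 < F (0 + k)"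
    using DERIV_pos_inc_right[OF dF[of 0]] by blast
  define k where "k = min (\<epsilon> / 2) pi"
  have k: "0 < k" "k < \<epsilon>" "k \<le> 2 * pi" using \<epsilon>(1) by (auto simp: k_def min_def)
  have "F k \<le> F (2 * pi)"
    using nonneg by (intro DERIV_nonneg_imp_nondecreasing[OF k(3)]) (blast intro: dF add_nonneg_nonneg)
  thus False using \<epsilon>(2)[OF k(1,2)] period by simp
qed

section \<open>A bound uniform in the eccentricity\<close>

text \<open>In the time \<open>\<tau>\<close> of the collision system, \<open>dt/d\<tau> = sqrt (1 + e * cos t)\<close>, and there
  \<open>coll_norm\<close> is the squared norm of the rescaled solution.\<close>

definition coll_norm :: "real \<Rightarrow> (real \<Rightarrow> real^4) \<Rightarrow> (real \<Rightarrow> real^4) \<Rightarrow> real \<Rightarrow> real" where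
  "coll_norm e p x t =
     sqrt (1 + e * cos t) * (p t \<bullet> p t) + (x t \<bullet> x t) / sqrt (1 + e * cos t)"

text \<open>The bound on \<open>D\<close> is
  \<open>(4 + \<rho>) * coll_norm / sqrt (1 + e * cos t)\<close>. In the time \<tau> the exponential
  growth rate is thus at most \<open>4 + \<rho>\<close>, whatever \<open>e\<close>.\<close>

lemma coll_norm_derivative:
  assumes e: "0 \<le> e" "e < 1" and sol: "ere_solution R e p x"
    and \<rho>: "0 \<le> \<rho>" "\<And>x. norm (R *v x) \<le> \<rho> * norm x"
  shows "\<exists>D. (coll_norm e p x has_real_derivative D) (at t) \<and>
    \<bar>D\<bar> \<le> (4 + \<rho>) * (p t \<bullet> p t + (x t \<bullet> x t) / (1 + e * cos t))"
proof -
  define g where "g = 1 + e * cos t"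
  have g: "0 < g" "g \<le> 2"
    using kepler_denominator_pos[OF e, of t] mult_mono[OF less_imp_le[OF e(2)] cos_le_one[of t]] e(1)
    by (auto simp: g_def mult_le_one intro: order_trans[OF mult_left_mono[OF cos_le_one]])
  define s where "s = sqrt g"
  have s: "s > 0" "s * s = g" "sqrt g = s" using g by (auto simp: s_def)
  define s' where "s' = - (e * sin t) / (2 * s)"
  have ds: "((\<lambda>t. sqrt (1 + e * cos t)) has_real_derivative s') (at t)"
    using g(1) unfolding s'_def s_def g_def by (auto intro!: derivative_eq_intros simp: divide_simps)
  \<comment> \<open>The square root of \<open>g\<close> has bounded slope even where
    \<open>g\<close> is nearly 0:
    \<open>(e * sin t)^2 \<le> 1 - (g - 1)^2 \<le> 4 * g\<close>.\<close>
  have s': "\<bar>s'\<bar> \<le> 1"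
  proof (rule power2_le_imp_le[of _ 1, simplified])
    have "(e * sin t)\<^sup>2 = e\<^sup>2 - (g - 1)\<^sup>2"
      unfolding g_def power_mult_distrib sin_squared_eq by (simp add: algebra_simps power_mult_distrib)
    also have "\<dots> \<le> 1 - (g - 1)\<^sup>2" using e by (simp add: power_le_one)
    also have "\<dots> \<le> 4 * g" using g(1) by (simp add: power2_eq_square algebra_simps)
    finally have "(e * sin t)\<^sup>2 / (4 * g) \<le> 1" using g(1) by simp
    thus "\<bar>s'\<bar>\<^sup>2 \<le> 1"
      unfolding s'_def using s by (simp add: power_divide power_mult_distrib power2_eq_square[of s])
  qed
  define P where "P = norm (p t)"
  \<comment> \<open>In the variables \<open>P\<close> and \<open>Y\<close> every term of the
    derivative, including the one with \<open>R / g\<close>, is a multiple of \<open>P^2\<close>,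
    \<open>Y^2\<close> or \<open>P * Y\<close> with a factor independent of
    \<open>e\<close>.\<close>
  define Y where "Y = norm (x t) / s"
  have PY: "P \<ge> 0" "Y \<ge> 0" "norm (x t) = s * Y" using s by (auto simp: P_def Y_def)
  have sq: "p t \<bullet> p t = P\<^sup>2" "x t \<bullet> x t = g * Y\<^sup>2"
    using PY(3) s(2) by (simp_all add: P_def dot_square_norm power_mult_distrib power2_eq_square[of s])
  define u where "u = p t \<bullet> x t"
  define w where "w = p t \<bullet> (R *v x t)"
  have u: "\<bar>u\<bar> \<le> s * (P * Y)"
    using Cauchy_Schwarz_ineq2[of "p t" "x t"] by (simp add: u_def PY(3) P_def ac_simps)
  have w: "\<bar>w\<bar> \<le> \<rho> * s * (P * Y)"
    using order_trans[OF Cauchy_Schwarz_ineq2[of "p t" "R *v x t"] mult_left_mono[OF \<rho>(2)]]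
    by (simp add: w_def PY(3) P_def ac_simps)
  define D where "D = s' * P\<^sup>2 + s * (2 * (w / g - u)) + (2 * u * s - g * Y\<^sup>2 * s') / (s * s)"
  have "(coll_norm e p x has_real_derivative D) (at t)"
    unfolding coll_norm_def[abs_def] D_def
    by (rule DERIV_cong[OF DERIV_add[OF
          DERIV_mult[OF ds ere_solution_inner_derivatives(3)[OF sol]]
          DERIV_divide[OF ere_solution_inner_derivatives(1)[OF sol] ds]]])
       (use s in \<open>simp_all add: g_def[symmetric] sq u_def w_def algebra_simps\<close>)
  moreover have "\<bar>D\<bar> \<le> (4 + \<rho>) * (P\<^sup>2 + Y\<^sup>2)"
  proof -
    have "D = s' * P\<^sup>2 - s' * Y\<^sup>2 + 2 * (w / s) - 2 * s * u + 2 * (u / s)"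
      unfolding D_def using s g by (simp add: divide_simps) (simp add: algebra_simps flip: s(2))
    moreover have "\<bar>s' * P\<^sup>2\<bar> \<le> P\<^sup>2" "\<bar>s' * Y\<^sup>2\<bar> \<le> Y\<^sup>2"
      using s' by (simp_all add: abs_mult mult_left_le_one_le)
    moreover have "\<bar>w / s\<bar> \<le> \<rho> * (P * Y)" "\<bar>u / s\<bar> \<le> P * Y"
      using w u s by (simp_all add: abs_divide divide_le_eq ac_simps)
    moreover have "\<bar>s * u\<bar> \<le> 2 * (P * Y)"
    proof -
      have "\<bar>s * u\<bar> \<le> s * (s * (P * Y))" using u s by (simp add: abs_mult)
      also have "\<dots> = g * (P * Y)" using s(2) by (simp flip: mult.assoc)
      also have "\<dots> \<le> 2 * (P * Y)" using g PY by (intro mult_right_mono) auto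
      finally show ?thesis .
    qed
    ultimately have "\<bar>D\<bar> \<le> P\<^sup>2 + Y\<^sup>2 + 2 * (\<rho> * (P * Y)) + 4 * (P * Y) + 2 * (P * Y)"
      by linarith
    also have "\<dots> = P\<^sup>2 + Y\<^sup>2 + (3 + \<rho>) * (2 * P * Y)" by (simp add: algebra_simps)
    also have "\<dots> \<le> P\<^sup>2 + Y\<^sup>2 + (3 + \<rho>) * (P\<^sup>2 + Y\<^sup>2)"
      using \<rho>(1) sum_squares_bound[of P Y] by (intro add_left_mono mult_left_mono) auto
    finally show ?thesis by (simp add: algebra_simps)
  qed
  moreover have "(x t \<bullet> x t) / g = Y\<^sup>2" using g by (simp add: sq)
  ultimately show ?thesis unfolding g_def[symmetric] sq(1) by auto
qed

lemma inner_le_coll_norm: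
  assumes "0 \<le> e" "e < 1"
  shows "2 * \<bar>p t \<bullet> x t\<bar> \<le> coll_norm e p x t"
    and "coll_norm e p x t =
      sqrt (1 + e * cos t) * (p t \<bullet> p t + (x t \<bullet> x t) / (1 + e * cos t))"
proof -
  define g where "g = 1 + e * cos t"
  have g: "0 < g" using kepler_denominator_pos[OF assms, of t] by (simp add: g_def)
  \<comment> \<open>The fourth root splits the product as
    \<open>(r * norm p) * (norm x / r)\<close>, whose factors have the two terms of
    \<open>coll_norm\<close> as squares.\<close>
  define r where "r = sqrt (sqrt g)"
  have r: "r > 0" "sqrt g = r\<^sup>2" using g by (simp_all add: r_def)
  have "2 * \<bar>p t \<bullet> x t\<bar> \<le> 2 * (r * norm (p t)) * (norm (x t) / r)"
    using Cauchy_Schwarz_ineq2[of "p t" "x t"] r by simp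
  also have "\<dots> \<le> (r * norm (p t))\<^sup>2 + (norm (x t) / r)\<^sup>2" by (rule sum_squares_bound)
  finally show "2 * \<bar>p t \<bullet> x t\<bar> \<le> coll_norm e p x t"
    unfolding coll_norm_def g_def[symmetric] r
    by (simp add: dot_square_norm power_mult_distrib power_divide)
  have "sqrt g * sqrt g = g" using g by simp
  hence "1 / sqrt g = sqrt g / g" using g by (simp add: field_simps)
  thus "coll_norm e p x t = sqrt g * (p t \<bullet> p t + (x t \<bullet> x t) / g)"
    unfolding coll_norm_def g_def[symmetric] by (simp add: divide_inverse algebra_simps)
qed

section \<open>Growth estimates for functions of one real variable\<close>

lemma exponential_bound_right:
  fixes M :: "real \<Rightarrow> real"
  assumes "a \<le> b" "\<And>t. a \<le> t \<Longrightarrow> t \<le> b \<Longrightarrow> \<exists>D. (M has_real_derivative D) (at t) \<and> D \<le> k * M t"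
  shows "M b \<le> M a * exp (k * (b - a))"
proof -
  have "M b * exp (- k * b) \<le> M a * exp (- k * a)"
  proof (rule DERIV_nonpos_imp_nonincreasing[OF assms(1)])
    fix t assume "a \<le> t" "t \<le> b"
    then obtain D where D: "(M has_real_derivative D) (at t)" "D \<le> k * M t" using assms(2) by blast
    have "((\<lambda>t. M t * exp (- k * t)) has_real_derivative (D - k * M t) * exp (- k * t)) (at t)"
      by (auto intro!: derivative_eq_intros D(1) simp: algebra_simps)
    thus "\<exists>y. ((\<lambda>t. M t * exp (- k * t)) has_real_derivative y) (at t) \<and> y \<le> 0"
      using D(2) by (meson diff_le_0_iff_le exp_ge_zero mult_nonpos_nonneg)
  qed
  thus ?thesis by (simp add: exp_minus exp_diff right_diff_distrib field_simps)
qed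

lemma exponential_bound_left:
  fixes M :: "real \<Rightarrow> real"
  assumes "a \<le> b" "\<And>t. a \<le> t \<Longrightarrow> t \<le> b \<Longrightarrow> \<exists>D. (M has_real_derivative D) (at t) \<and> - D \<le> k * M t"
  shows "M a \<le> M b * exp (k * (b - a))"
proof -
  have "M (- (- a)) \<le> M (- (- b)) * exp (k * (- a - - b))"
  proof (rule exponential_bound_right[of "- b" "- a" "\<lambda>t. M (- t)"])
    fix t assume "- b \<le> t" "t \<le> - a"
    then obtain D where D: "(M has_real_derivative D) (at (- t))" "- D \<le> k * M (- t)"
      using assms(2)[of "- t"] by auto
    have "((\<lambda>t. M (- t)) has_real_derivative - D) (at t)"
      using D(1) by (simp add: DERIV_mirror)
    thus "\<exists>D. ((\<lambda>t. M (- t)) has_real_derivative D) (at t) \<and> D \<le> k * M (- t)" using D(2) by blast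
  qed (use assms(1) in simp)
  thus ?thesis by simp
qed

text \<open>A function \<open>W\<close> that increases fast compared with the variation of \<open>M\<close> keeps the maximum of
  \<open>M\<close> near the ends: \<open>M + A * W\<close> increases and \<open>M - A * W\<close> decreases.\<close>

lemma bound_by_endpoints:
  fixes M W E :: "real \<Rightarrow> real"
  assumes t: "a \<le> t" "t \<le> b" and c: "0 < c" and K: "0 \<le> K"
    and M: "\<And>t. a \<le> t \<Longrightarrow> t \<le> b \<Longrightarrow> \<exists>D. (M has_real_derivative D) (at t) \<and> \<bar>D\<bar> \<le> K * E t"
    and W: "\<And>t. a \<le> t \<Longrightarrow> t \<le> b \<Longrightarrow> \<exists>D. (W has_real_derivative D) (at t) \<and> c * E t \<le> D"
    and WM: "\<And>t. \<bar>W t\<bar> \<le> M t"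
  shows "M t \<le> (1 + K / c) * max (M a) (M b)"
proof -
  \<comment> \<open>With this factor the growth of \<open>A * W\<close> dominates every change of
    \<open>M\<close>.\<close>
  define A where "A = K / c"
  have A: "A \<ge> 0" "A * c = K" using c K by (auto simp: A_def)
  have deriv: "\<exists>D D'. (M has_real_derivative D) (at u) \<and> (W has_real_derivative D') (at u) \<and> \<bar>D\<bar> \<le> A * D'"
    if u: "a \<le> u" "u \<le> b" for u
  proof -
    obtain D where D: "(M has_real_derivative D) (at u)" "\<bar>D\<bar> \<le> K * E u" using M[OF u] by blast
    obtain D' where D': "(W has_real_derivative D') (at u)" "c * E u \<le> D'" using W[OF u] by blast
    have "K * E u \<le> A * D'" using mult_left_mono[OF D'(2) A(1)] A(2) by (simp add: mult.assoc[symmetric])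
    with D D' show ?thesis by (meson order_trans)
  qed
  have mono: "M u + A * W u \<le> M v + A * W v" "M v - A * W v \<le> M u - A * W u"
    if uv: "a \<le> u" "u \<le> v" "v \<le> b" for u v
  proof -
    show "M u + A * W u \<le> M v + A * W v"
    proof (rule DERIV_nonneg_imp_nondecreasing[OF uv(2)])
      fix y assume "u \<le> y" "y \<le> v"
      then obtain D D' where "(M has_real_derivative D) (at y)" "(W has_real_derivative D') (at y)" "\<bar>D\<bar> \<le> A * D'"
        using deriv[of y] uv by auto
      thus "\<exists>z. ((\<lambda>y. M y + A * W y) has_real_derivative z) (at y) \<and> 0 \<le> z"
        by (intro exI[of _ "D + A * D'"]) (auto intro!: DERIV_add DERIV_cmult)
    qed
    show "M v - A * W v \<le> M u - A * W u"
    proof (rule DERIV_nonpos_imp_nonincreasing[OF uv(2)])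
      fix y assume "u \<le> y" "y \<le> v"
      then obtain D D' where "(M has_real_derivative D) (at y)" "(W has_real_derivative D') (at y)" "\<bar>D\<bar> \<le> A * D'"
        using deriv[of y] uv by auto
      thus "\<exists>z. ((\<lambda>y. M y - A * W y) has_real_derivative z) (at y) \<and> z \<le> 0"
        by (intro exI[of _ "D - A * D'"]) (auto intro!: DERIV_diff DERIV_cmult)
    qed
  qed
  have AW: "A * \<bar>W u\<bar> \<le> A * M u" for u using WM A(1) by (intro mult_left_mono)
  have ends: "(1 + A) * M u \<le> (1 + A) * max (M a) (M b)" if "u = a \<or> u = b" for u
    using A(1) that by (intro mult_left_mono) auto
  \<comment> \<open>The sign of \<open>W t\<close> selects the end: \<open>M + A * W\<close> carries
    the bound to \<open>b\<close>, and \<open>M - A * W\<close> to \<open>a\<close>. There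
    \<open>\<bar>W\<bar> \<le> M\<close> costs the factor \<open>1 + A\<close>.\<close>
  show ?thesis
  proof (cases "0 \<le> W t")
    case True
    hence "M t \<le> M t + A * W t" using A(1) by simp
    also have "\<dots> \<le> M b + A * W b" using mono(1)[OF t(1,2)] by simp
    also have "\<dots> \<le> (1 + A) * M b" using AW[of b] A(1)
      by (simp add: distrib_right) (smt (verit) mult_left_mono)
    finally show ?thesis using ends[of b] by (simp add: A_def)
  next
    case False
    hence "M t \<le> M t - A * W t" using A(1) by (simp add: mult_le_0_iff)
    also have "\<dots> \<le> M a - A * W a" using mono(2)[OF order_refl t] by simp
    also have "\<dots> \<le> (1 + A) * M a" using AW[of a] A(1)
      by (simp add: distrib_right) (smt (verit) mult_left_mono mult_minus_right)
    finally show ?thesis using ends[of a] by (simp add: A_def)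
  qed
qed

text \<open>On \<open>[0, pi - \<delta>]\<close> the bound runs forward from 0. On
  \<open>[pi + \<delta>, 2 * pi]\<close> it runs backward from \<open>2 * pi\<close>, where
  \<open>M\<close> again equals \<open>M 0\<close>. These two bounds are the endpoint data for the
  interval around \<open>pi\<close>.\<close>

lemma floquet_pair_coll_norm_bound:
  assumes \<kappa>: "0 < \<kappa>" "\<And>x. \<kappa> * (x \<bullet> x) \<le> x \<bullet> (R *v x)"
  shows "\<exists>C e0. e0 < 1 \<and> (\<forall>e p x p' x'. e0 \<le> e \<and> 0 \<le> e \<and> e < 1 \<and> floquet_pair R e p x p' x' \<longrightarrow>
    (\<forall>t\<in>{- pi..pi}. coll_norm e p x t + coll_norm e p' x' t \<le> C))"
proof -
  obtain \<rho> where \<rho>: "\<rho> \<ge> 0" "\<And>x. norm (R *v x) \<le> \<rho> * norm x"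
    using matrix_vector_norm_bound[of R] by blast
  \<comment> \<open>The cap at 1 lets the same constant bound the kinetic term
    \<open>p \<bullet> p\<close> from below.\<close>
  define \<mu> where "\<mu> = min \<kappa> 1"
  have \<mu>: "0 < \<mu>" "\<mu> \<le> 1" using \<kappa>(1) by (auto simp: \<mu>_def)
  have R: "\<mu> * (x \<bullet> x) \<le> x \<bullet> (R *v x)" for x
    by (rule order_trans[OF mult_right_mono \<kappa>(2)]) (simp_all add: \<mu>_def)
  \<comment> \<open>For \<open>c0 \<le> e < 1\<close> the two zones overlap in the right way: within
    \<delta> of \<open>pi\<close>, \<open>g \<le> 1 - c0^2 \<le> \<mu> / 2\<close>, and elsewhere
    \<open>g \<ge> 1 - c0 = \<mu> / 4\<close>. So \<open>c0\<close> is both the cosine of \<delta>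
    and the threshold for \<open>e\<close>.\<close>
  define c0 where "c0 = 1 - \<mu> / 4"
  have c0: "0 < c0" "c0 < 1" "1 - c0 * c0 \<le> \<mu> / 2" using \<mu> by (auto simp: c0_def algebra_simps)
  define \<delta> where "\<delta> = arccos c0"
  have \<delta>: "0 < \<delta>" "\<delta> < pi" "cos \<delta> = c0"
    using c0 arccos_lt_bounded[of c0] by (auto simp: \<delta>_def)
  define K where "K = 4 + \<rho>"
  \<comment> \<open>From \<open>M = sqrt g * EE\<close>, where \<open>sqrt g\<close> is at least
    \<open>sqrt \<mu> / 2\<close> outside the interval around \<open>pi\<close>.\<close>
  define k where "k = 2 * K / sqrt \<mu>"
  \<comment> \<open>The factors are the loss in \<open>bound_by_endpoints\<close> with rate
    \<open>\<mu> / 2\<close>, the growth over time at most \<open>pi\<close>, and the bound 2 for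
    \<open>M 0\<close>.\<close>
  define C where "C = (1 + K / (\<mu> / 2)) * (exp (k * pi) * 2)"
  have K: "K \<ge> 0" "k \<ge> 0" using \<rho>(1) \<mu> by (auto simp: K_def k_def)
  show ?thesis
  proof (rule exI[of _ C], rule exI[of _ c0], intro conjI allI impI ballI)
    show "c0 < 1" by (rule c0)
    fix e p x p' x' t
    assume "c0 \<le> e \<and> 0 \<le> e \<and> e < 1 \<and> floquet_pair R e p x p' x'" and t: "t \<in> {- pi..pi}"
    hence e: "c0 \<le> e" "0 \<le> e" "e < 1" and "floquet_pair R e p x p' x'" by auto
    then obtain \<alpha> \<beta> where s: "ere_solution R e p x" "ere_solution R e p' x'"
      "(norm (p 0))\<^sup>2 + (norm (x 0))\<^sup>2 + (norm (p' 0))\<^sup>2 + (norm (x' 0))\<^sup>2 = 1" "\<alpha>\<^sup>2 + \<beta>\<^sup>2 = 1"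
      and per: "p (t + 2 * pi) = \<alpha> *\<^sub>R p t - \<beta> *\<^sub>R p' t" "p' (t + 2 * pi) = \<beta> *\<^sub>R p t + \<alpha> *\<^sub>R p' t"
        "x (t + 2 * pi) = \<alpha> *\<^sub>R x t - \<beta> *\<^sub>R x' t" "x' (t + 2 * pi) = \<beta> *\<^sub>R x t + \<alpha> *\<^sub>R x' t" for t
      unfolding floquet_pair_def by metis
    define g where "g = (\<lambda>t. 1 + e * cos t)"
    have g: "0 < g t" for t using kepler_denominator_pos[OF e(2,3), of t] by (simp add: g_def)
    define M where "M = (\<lambda>t. coll_norm e p x t + coll_norm e p' x' t)"
    define W where "W = (\<lambda>t. p t \<bullet> x t + p' t \<bullet> x' t)"
    define EE where "EE = (\<lambda>t. (p t \<bullet> p t + (x t \<bullet> x t) / g t) + (p' t \<bullet> p' t + (x' t \<bullet> x' t) / g t))"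
    have EE: "0 \<le> EE t" for t using g[of t] by (simp add: EE_def)
    have M_eq: "M t = sqrt (g t) * EE t" for t
      unfolding M_def EE_def g_def inner_le_coll_norm(2)[OF e(2,3)] by (simp add: algebra_simps)
    have M: "\<exists>D. (M has_real_derivative D) (at t) \<and> \<bar>D\<bar> \<le> K * EE t" for t
    proof -
      obtain D1 where D1: "(coll_norm e p x has_real_derivative D1) (at t)"
        "\<bar>D1\<bar> \<le> K * (p t \<bullet> p t + (x t \<bullet> x t) / g t)"
        using coll_norm_derivative[OF e(2,3) s(1) \<rho>] unfolding K_def g_def by blast
      obtain D2 where D2: "(coll_norm e p' x' has_real_derivative D2) (at t)"
        "\<bar>D2\<bar> \<le> K * (p' t \<bullet> p' t + (x' t \<bullet> x' t) / g t)"
        using coll_norm_derivative[OF e(2,3) s(2) \<rho>] unfolding K_def g_def by blast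
      have "(M has_real_derivative D1 + D2) (at t)" unfolding M_def by (rule DERIV_add[OF D1(1) D2(1)])
      moreover have "\<bar>D1 + D2\<bar> \<le> K * EE t"
        using D1(2) D2(2) unfolding EE_def distrib_left[of K] by linarith
      ultimately show ?thesis by blast
    qed
    have W: "\<exists>D. (W has_real_derivative D) (at t) \<and> \<mu> / 2 * EE t \<le> D" if "g t \<le> \<mu> / 2" for t
    proof -
      \<comment> \<open>Of \<open>\<mu> * (x \<bullet> x)\<close> one half is kept and the other
        pays for \<open>- x \<bullet> x\<close>, which after multiplication by \<open>g\<close>
        costs at most \<open>\<mu> / 2\<close>.\<close>
      have low: "\<mu> / 2 * (p \<bullet> p + (x \<bullet> x) / g t) \<le> p \<bullet> p - x \<bullet> x + (x \<bullet> (R *v x)) / g t" for p x :: "real^4"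
      proof -
        have "\<mu> / 2 * (p \<bullet> p) \<le> p \<bullet> p" using \<mu> mult_right_mono[of "\<mu> / 2" 1 "p \<bullet> p"] by simp
        moreover have "\<mu> / 2 * (x \<bullet> x) + g t * (x \<bullet> x) \<le> x \<bullet> (R *v x)"
          using R[of x] mult_right_mono[OF that inner_ge_zero[of x]] by linarith
        hence "(\<mu> / 2 * (x \<bullet> x) + g t * (x \<bullet> x)) / g t \<le> (x \<bullet> (R *v x)) / g t"
          using g[of t] by (intro divide_right_mono) auto
        hence "\<mu> / 2 * ((x \<bullet> x) / g t) + x \<bullet> x \<le> (x \<bullet> (R *v x)) / g t"
          using g[of t] by (simp add: add_divide_distrib)
        ultimately show ?thesis unfolding distrib_left by linarith
      qed
      show ?thesis
        unfolding W_def EE_def distrib_left[of "\<mu> / 2"]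
        using DERIV_add[OF ere_solution_inner_derivatives(2)[OF s(1), of t]
            ere_solution_inner_derivatives(2)[OF s(2), of t]]
          low[of "p t" "x t"] low[of "p' t" "x' t"]
        unfolding g_def distrib_left by (meson add_mono)
    qed
    have WM: "\<bar>W t\<bar> \<le> M t" for t
      using inner_le_coll_norm(1)[OF e(2,3), of p t x] inner_le_coll_norm(1)[OF e(2,3), of p' t x']
      unfolding W_def M_def by linarith
    have exp_rate: "K * EE t \<le> k * M t" if "\<mu> / 4 \<le> g t" for t
    proof -
      have "sqrt \<mu> \<le> 2 * sqrt (g t)"
        using real_sqrt_le_mono[OF that] by (simp add: real_sqrt_divide)
      hence "1 \<le> 2 / sqrt \<mu> * sqrt (g t)" using \<mu> by (simp add: field_simps)
      from mult_left_mono[OF this, of "K * EE t"] show ?thesis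
        using K EE[of t] by (simp add: M_eq k_def ac_simps)
    qed
    have M0: "M 0 \<le> 2"
    proof -
      have a: "sqrt (1 + e) \<le> 2" "1 \<le> sqrt (1 + e)" using e by (auto intro!: real_le_lsqrt)
      have "coll_norm e p x 0 \<le> 2 * ((norm (p 0))\<^sup>2 + (norm (x 0))\<^sup>2)" for p x
      proof -
        have "sqrt (1 + e) * (norm (p 0))\<^sup>2 \<le> 2 * (norm (p 0))\<^sup>2" using a by (intro mult_right_mono) auto
        moreover have "(norm (x 0))\<^sup>2 / sqrt (1 + e) \<le> (norm (x 0))\<^sup>2 / 1"
          using a by (intro divide_left_mono) auto
        hence "(norm (x 0))\<^sup>2 / sqrt (1 + e) \<le> 2 * (norm (x 0))\<^sup>2"
          using zero_le_power2[of "norm (x 0)"] by linarith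
        ultimately show ?thesis unfolding coll_norm_def by (simp add: dot_square_norm)
      qed
      from add_mono[OF this[of p x] this[of p' x']] show ?thesis using s(3) by (simp add: M_def)
    qed
    have M_per: "M (t + 2 * pi) = M t" for t
    proof -
      have "M (t + 2 * pi) = (\<alpha>\<^sup>2 + \<beta>\<^sup>2) * M t"
        unfolding M_def coll_norm_def per cos_periodic
        by (simp add: inner_add_left inner_add_right inner_diff_left inner_diff_right inner_commute
          power2_eq_square add_divide_distrib diff_divide_distrib algebra_simps)
      thus ?thesis by (simp add: s)
    qed
    have outer: "\<mu> / 4 \<le> g t" if "\<bar>t\<bar> \<le> pi - \<delta>" for t
    proof -
      have "cos (pi - \<delta>) \<le> cos \<bar>t\<bar>" using that \<delta> by (subst cos_mono_le_eq) auto
      hence "e * (- c0) \<le> e * cos t" using \<delta>(3) e by (intro mult_left_mono) auto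
      moreover have "e * c0 \<le> c0" using e c0 by simp
      ultimately have "- c0 \<le> e * cos t" by simp
      thus ?thesis by (simp add: g_def c0_def)
    qed
    have outer': "\<mu> / 4 \<le> g t" if "pi + \<delta> \<le> t" "t \<le> 2 * pi" for t
      using outer[of "t - 2 * pi"] that by (simp add: g_def cos_diff)
    have inner': "g t \<le> \<mu> / 2" if "pi - \<delta> \<le> t" "t \<le> pi + \<delta>" for t
    proof -
      have "cos \<delta> \<le> cos \<bar>t - pi\<bar>" using that \<delta> by (subst cos_mono_le_eq) auto
      hence "e * cos t \<le> e * (- c0)" using \<delta>(3) e by (intro mult_left_mono) (auto simp: cos_diff)
      moreover have "c0 * c0 \<le> e * c0" using e c0 by simp
      ultimately have "e * cos t \<le> - (c0 * c0)" by simp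
      thus ?thesis using c0(3) by (simp add: g_def)
    qed
    define B where "B = exp (k * pi) * 2"
    have expb: "M 0 * exp (k * u) \<le> B" if "u \<le> pi" for u
      using mult_mono[OF M0, of "exp (k * u)" "exp (k * pi)"] that K(2)
      by (simp add: B_def mult_left_mono)
    have B1: "M t \<le> B" if "0 \<le> t" "t \<le> pi - \<delta>" for t
    proof -
      have "M t \<le> M 0 * exp (k * (t - 0))"
      proof (rule exponential_bound_right[OF that(1)])
        fix u assume "0 \<le> u" "u \<le> t"
        thus "\<exists>D. (M has_real_derivative D) (at u) \<and> D \<le> k * M u"
          using M[of u] exp_rate[OF outer, of u] that \<delta> by (smt (verit))
      qed
      also have "\<dots> \<le> B" using that \<delta> by (intro expb) auto
      finally show ?thesis .
    qed
    have B2: "M t \<le> B" if "pi + \<delta> \<le> t" "t \<le> 2 * pi" for t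
    proof -
      have "M t \<le> M (2 * pi) * exp (k * (2 * pi - t))"
      proof (rule exponential_bound_left[OF that(2)])
        fix u assume "t \<le> u" "u \<le> 2 * pi"
        thus "\<exists>D. (M has_real_derivative D) (at u) \<and> - D \<le> k * M u"
          using M[of u] exp_rate[OF outer', of u] that \<delta> by (smt (verit))
      qed
      also have "\<dots> \<le> B" using that \<delta> M_per[of 0] by (simp add: expb)
      finally show ?thesis .
    qed
    have B3: "M t \<le> C" if "pi - \<delta> \<le> t" "t \<le> pi + \<delta>" for t
    proof -
      have "M t \<le> (1 + K / (\<mu> / 2)) * max (M (pi - \<delta>)) (M (pi + \<delta>))"
        by (rule bound_by_endpoints[OF that, of _ _ _ EE W]) (use \<mu> K M W inner' WM in auto)
      also have "\<dots> \<le> (1 + K / (\<mu> / 2)) * B"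
        using B1[of "pi - \<delta>"] B2[of "pi + \<delta>"] \<delta> K \<mu> by (intro mult_left_mono) auto
      finally show ?thesis by (simp add: C_def B_def)
    qed
    have "B \<le> C"
      using K \<mu> mult_right_mono[of 1 "1 + K / (\<mu> / 2)" B] by (simp add: C_def B_def)
    hence full: "M t \<le> C" if "0 \<le> t" "t \<le> 2 * pi" for t
      using B1[of t] B2[of t] B3[of t] that by linarith
    show "coll_norm e p x t + coll_norm e p' x' t \<le> C"
    proof (cases "0 \<le> t")
      case True
      thus ?thesis using full[of t] t by (simp add: M_def)
    next
      case False
      thus ?thesis using full[of "t + 2 * pi"] M_per[of t] t by (simp add: M_def)
    qed
  qed
qed

section \<open>The collision limit\<close>

text \<open>The solution of \<open>\<theta>' = sqrt (1 + cos \<theta>)\<close> with value 0 at 0,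
  the time change of parabolic motion. It maps the line bijectively onto the open interval from
  \<open>- pi\<close> to \<open>pi\<close>.\<close>

definition true_anomaly :: "real \<Rightarrow> real" where
  "true_anomaly \<tau> = 2 * arctan (sinh (sqrt 2 * \<tau> / 2))"

lemma coll_q_bounds: "0 < coll_q \<tau>" "coll_q \<tau> \<le> 2" "(coll_q \<tau>)\<^sup>2 \<le> 2" "\<bar>coll_Q \<tau>\<bar> \<le> 2"
proof -
  define c where "c = cosh (sqrt 2 * \<tau> / 2)"
  have c: "1 \<le> c" by (simp add: c_def cosh_real_ge_1)
  show pos: "0 < coll_q \<tau>" by (simp add: coll_q_def)
  have "(coll_q \<tau>)\<^sup>2 = 2 / c\<^sup>2" by (simp add: coll_q_def c_def power_divide)
  also have "\<dots> \<le> 2 / 1" using c by (intro divide_left_mono) (auto simp: one_le_power)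
  finally show sq: "(coll_q \<tau>)\<^sup>2 \<le> 2" by simp
  show "coll_q \<tau> \<le> 2" by (rule power2_le_imp_le) (use sq in auto)
  have "\<bar>tanh (sqrt 2 * \<tau> / 2)\<bar> \<le> 1"
    using tanh_real_lt_1[of "sqrt 2 * \<tau> / 2"] tanh_real_gt_neg1[of "sqrt 2 * \<tau> / 2"] by linarith
  moreover have "sqrt 2 \<le> (2::real)" by (rule real_le_lsqrt) auto
  ultimately show "\<bar>coll_Q \<tau>\<bar> \<le> 2"
    unfolding coll_Q_def abs_mult using mult_mono[of "\<bar>sqrt 2\<bar>" 2 "\<bar>tanh (sqrt 2 * \<tau> / 2)\<bar>" 1] by simp
qed

lemma true_anomaly_props:
  "(true_anomaly has_real_derivative coll_q \<tau>) (at \<tau>)"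
  "1 + cos (true_anomaly \<tau>) = (coll_q \<tau>)\<^sup>2"
  "true_anomaly \<tau> \<in> {- pi..pi}" "true_anomaly 0 = 0"
proof -
  define s where "s = sinh (sqrt 2 * \<tau> / 2)"
  define c where "c = cosh (sqrt 2 * \<tau> / 2)"
  have c: "0 < c" "c\<^sup>2 = 1 + s\<^sup>2"
    using hyperbolic_pythagoras[of "sqrt 2 * \<tau> / 2"] by (simp_all add: c_def s_def)
  have "(true_anomaly has_real_derivative 2 * (inverse (1 + s\<^sup>2) * (c * (sqrt 2 / 2)))) (at \<tau>)"
    unfolding true_anomaly_def s_def c_def by (auto intro!: derivative_eq_intros)
  moreover have "2 * (inverse (1 + s\<^sup>2) * (c * (sqrt 2 / 2))) = coll_q \<tau>"
    unfolding coll_q_def c_def[symmetric] c(2)[symmetric] using c(1)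
    by (simp add: power2_eq_square field_simps)
  ultimately show "(true_anomaly has_real_derivative coll_q \<tau>) (at \<tau>)" by simp
  have "cos (true_anomaly \<tau>) = 2 * (cos (arctan s))\<^sup>2 - 1"
    unfolding true_anomaly_def s_def[symmetric] by (rule cos_double_cos)
  also have "(cos (arctan s))\<^sup>2 = 1 / c\<^sup>2"
    by (simp add: cos_arctan c(2) power_divide add_nonneg_nonneg)
  finally show "1 + cos (true_anomaly \<tau>) = (coll_q \<tau>)\<^sup>2"
    by (simp add: coll_q_def c_def power_divide)
  show "true_anomaly \<tau> \<in> {- pi..pi}"
    using arctan_bounded[of s] unfolding true_anomaly_def s_def[symmetric] by auto
qed (simp add: true_anomaly_def)

lemma coll_q_derivative:
  "(coll_q has_real_derivative - (coll_q \<tau> * coll_Q \<tau> / 2)) (at \<tau>)"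
proof -
  define s where "s = sinh (sqrt 2 * \<tau> / 2)"
  define c where "c = cosh (sqrt 2 * \<tau> / 2)"
  have c: "0 < c" by (simp add: c_def)
  have "(coll_q has_real_derivative - (sqrt 2 * (s * (sqrt 2 / 2))) / (c * c)) (at \<tau>)"
    unfolding coll_q_def s_def c_def by (auto intro!: derivative_eq_intros simp: less_imp_neq[symmetric])
  moreover have "- (sqrt 2 * (s * (sqrt 2 / 2))) / (c * c) = - (coll_q \<tau> * coll_Q \<tau> / 2)"
    unfolding coll_q_def coll_Q_def tanh_def c_def[symmetric] s_def[symmetric] by (simp add: ac_simps)
  ultimately show ?thesis by (rule DERIV_cong)
qed

text \<open>A symplectic scaling: the weights of \<open>p\<close> and \<open>x\<close> are
  reciprocal. Their logarithmic derivatives are \<open>- coll_Q / 4\<close> and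
  \<open>coll_Q / 4\<close>, the source of the diagonal terms in \<open>coll_B\<close>.\<close>

definition rescaled :: "(real \<Rightarrow> real^4) \<Rightarrow> (real \<Rightarrow> real^4) \<Rightarrow> real \<Rightarrow> real^(4+4)" where
  "rescaled p x \<tau> = joined (sqrt (coll_q \<tau>) *\<^sub>R p (true_anomaly \<tau>))
     (inverse (sqrt (coll_q \<tau>)) *\<^sub>R x (true_anomaly \<tau>))"

text \<open>Because time and scaling are the parabolic ones for every \<open>e\<close>, the
  eccentricity survives in one scalar coefficient in front of \<open>R\<close>. It tends to 0 with
  \<open>1 - e\<close>, since
  \<open>1 + cos (true_anomaly \<tau>) = (coll_q \<tau>)^2\<close>.\<close>

lemma rescaled_derivative:
  assumes e: "0 \<le> e" "e < 1" and sol: "ere_solution R e p x"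
  shows "(rescaled p x has_vector_derivative
    (symp_J ** coll_B R \<tau>) *v rescaled p x \<tau> +
    joined (((coll_q \<tau>)\<^sup>2 / (1 + e * cos (true_anomaly \<tau>)) - 1) *\<^sub>R (R *v lower (rescaled p x \<tau>))) 0)
    (at \<tau>)"
proof -
  define r where "r = (\<lambda>\<tau>. sqrt (coll_q \<tau>))"
  define \<theta> where "\<theta> = true_anomaly \<tau>"
  define g where "g = 1 + e * cos \<theta>"
  have r: "r \<tau> > 0" "coll_q \<tau> = r \<tau> * r \<tau>" using coll_q_bounds(1)[of \<tau>] by (simp_all add: r_def)
  have r_eq: "sqrt (coll_q s) = r s" for s by (simp add: r_def)
  have dr: "(r has_real_derivative - (coll_Q \<tau> / 4) * r \<tau>) (at \<tau>)"
    unfolding r_def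
    by (rule DERIV_cong[OF DERIV_chain2[OF DERIV_real_sqrt coll_q_derivative]])
       (use coll_q_bounds(1)[of \<tau>] in \<open>simp_all add: real_div_sqrt field_simps\<close>)
  have dr': "((\<lambda>\<tau>. inverse (r \<tau>)) has_real_derivative (coll_Q \<tau> / 4) * inverse (r \<tau>)) (at \<tau>)"
    by (rule DERIV_cong[OF DERIV_inverse'[OF dr]]) (use r(1) in \<open>auto simp: field_simps\<close>)
  have comp: "((\<lambda>\<tau>. f (true_anomaly \<tau>)) has_vector_derivative coll_q \<tau> *\<^sub>R f') (at \<tau>)"
    if "(f has_vector_derivative f') (at \<theta>)" for f :: "real \<Rightarrow> real^4" and f'
    using vector_diff_chain_at[OF true_anomaly_props(1)[unfolded has_real_derivative_iff_has_vector_derivative]]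
      that unfolding \<theta>_def o_def by blast
  have dp: "((\<lambda>\<tau>. r \<tau> *\<^sub>R p (true_anomaly \<tau>)) has_vector_derivative
      r \<tau> *\<^sub>R (coll_q \<tau> *\<^sub>R (- (JJ *v p \<theta>) - x \<theta> + (1 / g) *\<^sub>R (R *v x \<theta>)))
        + (- (coll_Q \<tau> / 4) * r \<tau>) *\<^sub>R p \<theta>) (at \<tau>)"
    using has_vector_derivative_scaleR[OF dr comp] sol unfolding ere_solution_def \<theta>_def g_def by blast
  have dx: "((\<lambda>\<tau>. inverse (r \<tau>) *\<^sub>R x (true_anomaly \<tau>)) has_vector_derivative
      inverse (r \<tau>) *\<^sub>R (coll_q \<tau> *\<^sub>R (p \<theta> - JJ *v x \<theta>))
        + ((coll_Q \<tau> / 4) * inverse (r \<tau>)) *\<^sub>R x \<theta>) (at \<tau>)"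
    using has_vector_derivative_scaleR[OF dr' comp] sol unfolding ere_solution_def \<theta>_def g_def by blast
  have upper_eq: "r \<tau> *\<^sub>R (coll_q \<tau> *\<^sub>R (- (JJ *v p \<theta>) - x \<theta> + (1 / g) *\<^sub>R (R *v x \<theta>)))
        + (- (coll_Q \<tau> / 4) * r \<tau>) *\<^sub>R p \<theta> =
      - (coll_Q \<tau> / 4) *\<^sub>R (r \<tau> *\<^sub>R p \<theta>) - coll_q \<tau> *\<^sub>R (JJ *v (r \<tau> *\<^sub>R p \<theta>))
        - (coll_q \<tau>)\<^sup>2 *\<^sub>R (inverse (r \<tau>) *\<^sub>R x \<theta>) + R *v (inverse (r \<tau>) *\<^sub>R x \<theta>)
        + ((coll_q \<tau>)\<^sup>2 / g - 1) *\<^sub>R (R *v (inverse (r \<tau>) *\<^sub>R x \<theta>))"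
    using r(1) unfolding r(2)
    by (simp add: vec_eq_iff matrix_vector_mult_scaleR power2_eq_square algebra_simps)
  have lower_eq: "inverse (r \<tau>) *\<^sub>R (coll_q \<tau> *\<^sub>R (p \<theta> - JJ *v x \<theta>))
        + ((coll_Q \<tau> / 4) * inverse (r \<tau>)) *\<^sub>R x \<theta> =
      r \<tau> *\<^sub>R p \<theta> + (coll_Q \<tau> / 4) *\<^sub>R (inverse (r \<tau>) *\<^sub>R x \<theta>)
        - coll_q \<tau> *\<^sub>R (JJ *v (inverse (r \<tau>) *\<^sub>R x \<theta>)) + 0"
    using r(1) unfolding r(2)
    by (simp add: vec_eq_iff matrix_vector_mult_scaleR algebra_simps)
  show ?thesis
    unfolding rescaled_def[abs_def] coll_field upper_joined lower_joined joined_add[symmetric]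
      r_eq \<theta>_def[symmetric] g_def[symmetric] upper_eq[symmetric] lower_eq[symmetric]
    by (rule has_vector_derivative_joined[OF dp dx])
qed

section \<open>Solutions of the collision system as limits\<close>

lemma coll_field_bound:
  "\<exists>L\<ge>0. \<forall>\<tau> z. norm ((symp_J ** coll_B R \<tau>) *v z) \<le> L * norm z"
proof -
  obtain \<rho> where \<rho>: "\<rho> \<ge> 0" "\<And>x. norm (R *v x) \<le> \<rho> * norm x"
    using matrix_vector_norm_bound[of R] by blast
  have "norm ((symp_J ** coll_B R \<tau>) *v joined p x) \<le> (9 + \<rho>) * norm (joined p x)" for \<tau> p x
  proof -
    define q where "q = coll_q \<tau>"
    define Q where "Q = coll_Q \<tau>"
    define n where "n = norm (joined p x)"
    have n: "norm p \<le> n" "norm x \<le> n" "0 \<le> n"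
      unfolding n_def by (simp_all add: norm_le_norm_joined)
    have b: "norm (c *\<^sub>R v) \<le> d * n" if "\<bar>c\<bar> \<le> d" "norm v \<le> n" for c d and v :: "real^4"
      using that by (simp add: mult_mono)
    have q: "\<bar>q\<bar> \<le> 2" "\<bar>q\<^sup>2\<bar> \<le> 2" "\<bar>Q / 4\<bar> \<le> 1 / 2" "\<bar>- (Q / 4)\<bar> \<le> 1 / 2"
      using coll_q_bounds[of \<tau>] by (auto simp: q_def Q_def)
    have terms: "norm (- (Q / 4) *\<^sub>R p) \<le> 1 / 2 * n" "norm (q *\<^sub>R (JJ *v p)) \<le> 2 * n"
      "norm (q\<^sup>2 *\<^sub>R x) \<le> 2 * n" "norm ((Q / 4) *\<^sub>R x) \<le> 1 / 2 * n" "norm (q *\<^sub>R (JJ *v x)) \<le> 2 * n"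
      by (intro b q; simp add: norm_JJ n)+
    have "norm (R *v x) \<le> \<rho> * n" by (rule order_trans[OF \<rho>(2)]) (simp add: n \<rho>(1) mult_left_mono)
    moreover have "norm (A - B - C + D) \<le> norm A + norm B + norm C + norm D" for A B C D :: "real^4"
      using norm_triangle_ineq[of "A - B - C" D] norm_triangle_ineq4[of "A - B" C]
        norm_triangle_ineq4[of A B] by linarith
    moreover have "norm (A + B - C) \<le> norm A + norm B + norm C" for A B C :: "real^4"
      using norm_triangle_ineq4[of "A + B" C] norm_triangle_ineq[of A B] by linarith
    ultimately have
      "norm (- (Q / 4) *\<^sub>R p - q *\<^sub>R (JJ *v p) - q\<^sup>2 *\<^sub>R x + R *v x) +
       norm (p + (Q / 4) *\<^sub>R x - q *\<^sub>R (JJ *v x)) \<le>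
        (1 / 2 * n + 2 * n + 2 * n + \<rho> * n) + (n + 1 / 2 * n + 2 * n)"
      using terms n(1) by (smt (verit))
    also have "\<dots> \<le> (9 + \<rho>) * n" using n(3) by (simp add: algebra_simps)
    finally show ?thesis
      unfolding coll_field upper_joined lower_joined q_def[symmetric] Q_def[symmetric] n_def[symmetric]
      by (rule order_trans[OF norm_joined_le])
  qed
  hence "norm ((symp_J ** coll_B R \<tau>) *v z) \<le> (9 + \<rho>) * norm z" for \<tau> z
    by (metis joined_upper_lower)
  thus ?thesis using \<rho>(1) by (intro exI[of _ "9 + \<rho>"]) auto
qed

lemma collision_solution_exists:
  "\<exists>Z. Z 0 = z0 \<and> (\<forall>\<tau>. (Z has_vector_derivative (symp_J ** coll_B R \<tau>) *v Z \<tau>) (at \<tau>))"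
proof -
  obtain L where L: "\<And>\<tau> z. norm ((symp_J ** coll_B R \<tau>) *v z) \<le> L * norm z"
    using coll_field_bound[of R] by blast
  have q: "continuous_on UNIV (\<lambda>s::real \<times> (real^(4+4)). coll_q (fst s))"
    unfolding coll_q_def by (intro continuous_intros) (simp_all add: less_imp_neq[symmetric])
  have Q: "continuous_on UNIV (\<lambda>s::real \<times> (real^(4+4)). coll_Q (fst s))"
    unfolding coll_Q_def by (intro continuous_intros) (simp_all add: less_imp_neq[symmetric])
  have "continuous_on UNIV (\<lambda>(\<tau>, z). (symp_J ** coll_B R \<tau>) *v z)"
    unfolding coll_field case_prod_beta by (intro continuous_intros q Q) auto
  from linear_system_solution[OF this L, of z0] show ?thesis by metis
qed

text \<open>Gronwall for the difference \<open>y\<close> from \<open>Z\<close>. The perturbation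
  acts on \<open>y + Z\<close>: its part on \<open>y\<close> only enlarges the Lipschitz constant,
  as \<open>\<bar>a\<bar> \<le> 1\<close>, while its part on the fixed \<open>Z\<close> is a source
  of size \<open>(1 - e) * B\<close> on the compact time interval.\<close>

lemma collision_limit:
  assumes e: "\<And>n. 0 \<le> e n" "\<And>n. e n < 1" "e \<longlonglongrightarrow> 1"
    and sol: "\<And>n. ere_solution R (e n) (p n) (x n)"
    and Z: "\<And>\<tau>. (Z has_vector_derivative (symp_J ** coll_B R \<tau>) *v Z \<tau>) (at \<tau>)"
    and init: "(\<lambda>n. rescaled (p n) (x n) 0) \<longlonglongrightarrow> Z 0"
  shows "(\<lambda>n. rescaled (p n) (x n) T) \<longlonglongrightarrow> Z T"
proof -
  obtain \<rho> where \<rho>: "\<rho> \<ge> 0" "\<And>x. norm (R *v x) \<le> \<rho> * norm x"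
    using matrix_vector_norm_bound[of R] by blast
  obtain L where L: "L \<ge> 0" "\<And>\<tau> z. norm ((symp_J ** coll_B R \<tau>) *v z) \<le> L * norm z"
    using coll_field_bound[of R] by blast
  define a where "a = (\<lambda>n \<tau>. (coll_q \<tau>)\<^sup>2 / (1 + e n * cos (true_anomaly \<tau>)) - 1)"
  have a: "\<bar>a n \<tau>\<bar> \<le> 1" "\<bar>a n \<tau>\<bar> \<le> (1 - e n) * (2 / (coll_q \<tau>)\<^sup>2)" for n \<tau>
  proof -
    define c where "c = cos (true_anomaly \<tau>)"
    define g where "g = 1 + e n * c"
    have q: "(coll_q \<tau>)\<^sup>2 = 1 + c" "0 < (coll_q \<tau>)\<^sup>2" "c \<le> 1" "- 1 \<le> c"
      using true_anomaly_props(2)[of \<tau>] coll_q_bounds(1)[of \<tau>] by (simp_all add: c_def)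
    have g: "0 < g" using kepler_denominator_pos[OF e(1)[of n] e(2)[of n], of "true_anomaly \<tau>"]
      by (simp add: g_def c_def)
    \<comment> \<open>For \<open>c \<ge> 0\<close> one has \<open>g \<ge> 1\<close> and
      \<open>q^2 \<le> 2\<close>; for \<open>c < 0\<close> even \<open>g \<ge> 1 + c = q^2\<close>.
      Hence \<open>q^2 / g\<close> lies between 0 and 2, uniformly in time and
      \<open>e\<close>.\<close>
    have two: "(coll_q \<tau>)\<^sup>2 \<le> 2 * g"
    proof (cases "0 \<le> c")
      case True
      hence "0 \<le> e n * c" using e(1) by simp
      thus ?thesis using q by (simp add: g_def)
    next
      case False
      hence "1 * c \<le> e n * c" using e(2)[of n] by (intro mult_right_mono_neg) auto
      thus ?thesis using q(1,2) by (simp add: g_def)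
    qed
    have an: "a n \<tau> = (1 - e n) * c / g"
      unfolding a_def c_def[symmetric] g_def[symmetric] q(1) using g
      by (simp add: divide_simps) (simp add: g_def algebra_simps)
    have "0 < (coll_q \<tau>)\<^sup>2 / g" by (rule divide_pos_pos[OF q(2) g])
    moreover have "(coll_q \<tau>)\<^sup>2 / g \<le> 2" unfolding pos_divide_le_eq[OF g] by (rule two)
    ultimately show "\<bar>a n \<tau>\<bar> \<le> 1" unfolding a_def c_def[symmetric] g_def[symmetric] by linarith
    have "\<bar>a n \<tau>\<bar> = (1 - e n) * \<bar>c\<bar> / g" unfolding an using e(2)[of n] g by (simp add: abs_mult)
    also have "\<dots> \<le> (1 - e n) * 1 / ((coll_q \<tau>)\<^sup>2 / 2)"
      by (rule frac_le) (use e(2)[of n] q two in \<open>auto simp: abs_le_iff intro!: mult_left_mono\<close>)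
    finally show "\<bar>a n \<tau>\<bar> \<le> (1 - e n) * (2 / (coll_q \<tau>)\<^sup>2)" by simp
  qed
  have "continuous_on {- \<bar>T\<bar>..\<bar>T\<bar>} (\<lambda>\<tau>. 2 / (coll_q \<tau>)\<^sup>2 * (\<rho> * norm (Z \<tau>)))"
  proof -
    have "continuous_on {- \<bar>T\<bar>..\<bar>T\<bar>} Z"
      using Z by (meson continuous_at_imp_continuous_on has_vector_derivative_continuous)
    moreover have "continuous_on {- \<bar>T\<bar>..\<bar>T\<bar>} coll_q"
      using coll_q_derivative by (meson DERIV_isCont continuous_at_imp_continuous_on)
    ultimately show ?thesis
      using coll_q_bounds(1) by (intro continuous_intros) (auto simp: less_imp_neq[symmetric])
  qed
  from compact_imp_bounded[OF compact_continuous_image[OF this compact_Icc]]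
  obtain B where "\<And>y. y \<in> (\<lambda>\<tau>. 2 / (coll_q \<tau>)\<^sup>2 * (\<rho> * norm (Z \<tau>))) ` {- \<bar>T\<bar>..\<bar>T\<bar>} \<Longrightarrow> norm y \<le> B"
    unfolding bounded_iff by blast
  hence B: "2 / (coll_q \<tau>)\<^sup>2 * (\<rho> * norm (Z \<tau>)) \<le> B" if "\<bar>\<tau>\<bar> \<le> \<bar>T\<bar>" for \<tau>
    using that by (fastforce simp: abs_le_iff)
  have B0: "0 \<le> B" by (rule order_trans[OF _ B[of 0]]) (use \<rho>(1) in auto)
  define y where "y = (\<lambda>n \<tau>. rescaled (p n) (x n) \<tau> - Z \<tau>)"
  define k where "k = exp ((2 * (L + \<rho>) + 1) * \<bar>T\<bar>)"
  have main: "(norm (y n T))\<^sup>2 \<le> ((norm (y n 0))\<^sup>2 + ((1 - e n) * B)\<^sup>2) * k" for n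
    unfolding k_def
  proof (rule gronwall)
    define y' where "y' = (\<lambda>\<tau>. (symp_J ** coll_B R \<tau>) *v y n \<tau>
      + joined (a n \<tau> *\<^sub>R (R *v lower (y n \<tau>))) 0 + joined (a n \<tau> *\<^sub>R (R *v lower (Z \<tau>))) 0)"
    show "(y n has_vector_derivative y' \<tau>) (at \<tau>)" for \<tau>
    proof -
      have split: "joined (a n \<tau> *\<^sub>R (R *v lower (y n \<tau>))) 0 + joined (a n \<tau> *\<^sub>R (R *v lower (Z \<tau>))) 0
          = joined (a n \<tau> *\<^sub>R (R *v lower (rescaled (p n) (x n) \<tau>))) 0"
        unfolding joined_add[symmetric] y_def
          linear_diff[OF bounded_linear.linear[OF bounded_linear_lower]]
        by (simp add: matrix_vector_mult_diff_distrib scaleR_diff_right)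
      have "y' \<tau> = ((symp_J ** coll_B R \<tau>) *v rescaled (p n) (x n) \<tau>
          + joined (a n \<tau> *\<^sub>R (R *v lower (rescaled (p n) (x n) \<tau>))) 0) - (symp_J ** coll_B R \<tau>) *v Z \<tau>"
        unfolding y'_def add.assoc split unfolding y_def by (simp add: matrix_vector_mult_diff_distrib)
      thus ?thesis
        unfolding y_def using has_vector_derivative_diff[OF rescaled_derivative[OF e(1,2) sol] Z]
        by (simp add: a_def)
    qed
    show "norm (y' \<tau>) \<le> (L + \<rho>) * norm (y n \<tau>) + (1 - e n) * B" if "\<bar>\<tau>\<bar> \<le> \<bar>T\<bar>" for \<tau>
    proof -
      have low: "norm (lower z) \<le> norm z" for z :: "real^(4+4)"
        using norm_le_norm_joined(2)[where p = "upper z" and x = "lower z"] by simp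
      have pert: "norm (joined (a n \<tau> *\<^sub>R (R *v lower z)) 0) \<le> \<bar>a n \<tau>\<bar> * (\<rho> * norm z)" for z :: "real^(4+4)"
      proof -
        have "norm (joined (a n \<tau> *\<^sub>R (R *v lower z)) 0) \<le> \<bar>a n \<tau>\<bar> * norm (R *v lower z)"
          using norm_joined_le[of "a n \<tau> *\<^sub>R (R *v lower z)" 0] by simp
        also have "\<dots> \<le> \<bar>a n \<tau>\<bar> * (\<rho> * norm z)"
          by (intro mult_left_mono order_trans[OF \<rho>(2)] low) (simp_all add: \<rho>(1) low)
        finally show ?thesis .
      qed
      have "norm (joined (a n \<tau> *\<^sub>R (R *v lower (y n \<tau>))) 0) \<le> 1 * (\<rho> * norm (y n \<tau>))"
        by (rule order_trans[OF pert mult_right_mono]) (use a \<rho>(1) in auto)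
      moreover have "norm (joined (a n \<tau> *\<^sub>R (R *v lower (Z \<tau>))) 0) \<le> (1 - e n) * B"
      proof -
        have "norm (joined (a n \<tau> *\<^sub>R (R *v lower (Z \<tau>))) 0) \<le>
            (1 - e n) * (2 / (coll_q \<tau>)\<^sup>2) * (\<rho> * norm (Z \<tau>))"
          by (rule order_trans[OF pert mult_right_mono]) (use a \<rho>(1) in auto)
        also have "\<dots> \<le> (1 - e n) * B"
          unfolding mult.assoc using B[OF that] e(2)[of n] by (intro mult_left_mono) (auto simp: mult.assoc)
        finally show ?thesis .
      qed
      moreover have "norm ((symp_J ** coll_B R \<tau>) *v y n \<tau>) \<le> L * norm (y n \<tau>)" by (rule L)
      ultimately show ?thesis
        unfolding y'_def distrib_right
        by (smt (verit) norm_triangle_ineq mult_1)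
    qed
  qed (use L \<rho> B0 e(2)[of n] in auto)
  have "(\<lambda>n. ((norm (y n 0))\<^sup>2 + ((1 - e n) * B)\<^sup>2) * k) \<longlonglongrightarrow> ((norm (Z 0 - Z 0))\<^sup>2 + ((1 - 1) * B)\<^sup>2) * k"
    unfolding y_def by (intro tendsto_intros init e(3))
  hence "(\<lambda>n. (norm (y n T))\<^sup>2) \<longlonglongrightarrow> 0"
    by (intro tendsto_sandwich[OF _ always_eventually[OF allI[OF main]] tendsto_const]) auto
  hence "(\<lambda>n. sqrt ((norm (y n T))\<^sup>2)) \<longlonglongrightarrow> sqrt 0" by (rule tendsto_real_sqrt)
  hence "(\<lambda>n. norm (y n T)) \<longlonglongrightarrow> 0" by simp
  thus ?thesis unfolding y_def by (simp add: LIM_zero_iff tendsto_norm_zero_iff)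
qed

text \<open>The weight is \<open>coll_q\<close> in \<open>rescaled\<close> but
  \<open>sqrt (1 + e * cos t)\<close> in \<open>coll_norm\<close>. They agree up to a factor 2 in
  the region \<open>1 - e \<le> (coll_q T)^2\<close>, which contains any given \<open>T\<close> once
  \<open>e\<close> is close enough to 1.\<close>

lemma norm_rescaled_le:
  assumes e: "0 \<le> e" "e < 1" and T: "1 - e \<le> (coll_q T)\<^sup>2"
  shows "(norm (rescaled p x T))\<^sup>2 \<le> 2 * coll_norm e p x (true_anomaly T)"
proof -
  define \<theta> where "\<theta> = true_anomaly T"
  define g where "g = 1 + e * cos \<theta>"
  define q where "q = coll_q T"
  have q: "0 < q" "q\<^sup>2 = 1 + cos \<theta>" "1 - e \<le> q\<^sup>2"
    using coll_q_bounds(1)[of T] true_anomaly_props(2)[of T] T by (simp_all add: q_def \<theta>_def)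
  have g: "0 < g" using kepler_denominator_pos[OF e, of \<theta>] by (simp add: g_def)
  have "(1 - e) * cos \<theta> \<le> (1 - e) * 1" "(1 - e) * (- 1) \<le> (1 - e) * cos \<theta>"
    using e(2) by (intro mult_left_mono; simp)+
  hence d: "\<bar>q\<^sup>2 - g\<bar> \<le> 1 - e" unfolding q(2) g_def by (simp add: algebra_simps abs_le_iff)
  have "q \<le> 2 * sqrt g"
  proof (rule power2_le_imp_le)
    define u where "u = e * cos \<theta>"
    have "0 \<le> u \<or> cos \<theta> \<le> u"
      using e mult_right_mono_neg[of e 1 "cos \<theta>"] by (cases "0 \<le> cos \<theta>") (auto simp: u_def)
    hence "q\<^sup>2 \<le> 4 * g"
      using cos_le_one[of \<theta>] g unfolding q(2) g_def u_def[symmetric] by (smt (verit))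
    thus "q\<^sup>2 \<le> (2 * sqrt g)\<^sup>2" using g by (simp add: power_mult_distrib)
  qed (use g in simp)
  \<comment> \<open>The assumption on \<open>T\<close> enters here:
    \<open>g \<le> q^2 + (1 - e) \<le> 2 * q^2\<close>.\<close>
  moreover have "sqrt g \<le> 2 * q"
  proof (rule real_le_lsqrt)
    show "g \<le> (2 * q)\<^sup>2" using d q(3) zero_le_power2[of q] by (simp add: power_mult_distrib)
  qed (use q in auto)
  ultimately have "q * (p \<theta> \<bullet> p \<theta>) \<le> 2 * sqrt g * (p \<theta> \<bullet> p \<theta>)"
    and "(x \<theta> \<bullet> x \<theta>) / q \<le> (x \<theta> \<bullet> x \<theta>) / (sqrt g / 2)"
    using g q(1) by (intro mult_right_mono divide_left_mono; simp)+
  moreover have "(norm (rescaled p x T))\<^sup>2 = q * (p \<theta> \<bullet> p \<theta>) + (x \<theta> \<bullet> x \<theta>) / q"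
    using q(1) unfolding rescaled_def norm_joined \<theta>_def[symmetric] q_def[symmetric]
    by (simp add: power_mult_distrib dot_square_norm power_inverse divide_inverse mult.commute)
  ultimately show ?thesis
    unfolding coll_norm_def \<theta>_def[symmetric] g_def[symmetric] by (simp add: algebra_simps)
qed

lemma hyperbolic_near_collision:
  assumes \<kappa>: "0 < \<kappa>" "\<And>x. \<kappa> * (x \<bullet> x) \<le> x \<bullet> (R *v x)"
    and nondeg: "collision_nondegenerate R"
  shows "\<exists>\<epsilon>>0. \<forall>e\<in>{0..<1}. 1 - e < \<epsilon> \<longrightarrow> ere_hyperbolic R e"
proof (rule ccontr)
  assume contra: "\<not> ?thesis"
  obtain C e0 where C: "e0 < 1" "\<And>e p x p' x' t. e0 \<le> e \<Longrightarrow> 0 \<le> e \<Longrightarrow> e < 1 \<Longrightarrow>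
      floquet_pair R e p x p' x' \<Longrightarrow> t \<in> {- pi..pi} \<Longrightarrow>
      coll_norm e p x t + coll_norm e p' x' t \<le> C"
    using floquet_pair_coll_norm_bound[OF \<kappa>] by blast
  have "\<exists>e. 0 \<le> e \<and> e < 1 \<and> e0 \<le> e \<and> 1 - e < inverse (real (Suc n)) \<and> \<not> ere_hyperbolic R e" for n
  proof -
    have "0 < min (inverse (real (Suc n))) (1 - e0)" using C(1) by simp
    then obtain e where "e \<in> {0..<1}" "1 - e < min (inverse (real (Suc n))) (1 - e0)" "\<not> ere_hyperbolic R e"
      using contra by blast
    thus ?thesis by (intro exI[of _ e]) auto
  qed
  then obtain e where e: "\<And>n. 0 \<le> e n" "\<And>n. e n < 1" "\<And>n. e0 \<le> e n"
    "\<And>n. 1 - e n < inverse (real (Suc n))" "\<And>n. \<not> ere_hyperbolic R (e n)" by metis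
  have e_lim: "e \<longlonglongrightarrow> 1"
  proof -
    have "(\<lambda>n. 1 - e n) \<longlonglongrightarrow> 0"
      by (rule tendsto_sandwich[OF _ _ tendsto_const LIMSEQ_inverse_real_of_nat])
         (use e in \<open>auto intro!: always_eventually less_imp_le\<close>)
    from tendsto_diff[OF tendsto_const[of 1] this] show ?thesis by simp
  qed
  have "\<forall>n. \<exists>p x p' x'. floquet_pair R (e n) p x p' x'"
    using not_hyperbolic_floquet_pair[OF e(1,2,5)] by metis
  then obtain p x p' x' where F: "\<And>n. floquet_pair R (e n) (p n) (x n) (p' n) (x' n)" by metis
  hence sol: "\<And>n. ere_solution R (e n) (p n) (x n)" "\<And>n. ere_solution R (e n) (p' n) (x' n)"
    and unit: "\<And>n. (norm (p n 0))\<^sup>2 + (norm (x n 0))\<^sup>2 + (norm (p' n 0))\<^sup>2 + (norm (x' n 0))\<^sup>2 = 1"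
    by (simp_all add: floquet_pair_def)
  \<comment> \<open>All initial data form one unit vector, so a single subsequence serves both
    solutions and the limit is again a unit vector.\<close>
  define v where "v = (\<lambda>n. joined (joined (p n 0) (x n 0)) (joined (p' n 0) (x' n 0)))"
  have norm_v: "norm (v n) = 1" for n
  proof -
    have "(norm (v n))\<^sup>2 = 1" using unit[of n] by (simp add: v_def norm_joined)
    thus ?thesis by (simp add: power2_eq_1_iff) (metis norm_ge_zero not_numeral_le_zero zero_le_one
      le_minus_one_simps(3))
  qed
  hence "bounded (range v)" by (auto simp: bounded_iff)
  then obtain l r where r: "strict_mono r" and l: "(v \<circ> r) \<longlonglongrightarrow> l"
    using bounded_imp_convergent_subsequence by blast
  have "(\<lambda>n. norm ((v \<circ> r) n)) \<longlonglongrightarrow> norm l" by (rule tendsto_norm[OF l])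
  hence norm_l: "norm l = 1" by (simp add: o_def norm_v LIMSEQ_const_iff)
  note up = bounded_linear.tendsto[OF bounded_linear_upper]
  note lo = bounded_linear.tendsto[OF bounded_linear_lower]
  have q0: "sqrt (coll_q 0) > 0" using coll_q_bounds(1) by simp
  \<comment> \<open>Initial data in the rescaled coordinates. The map is injective, so
    \<open>Z\<close> or \<open>Z'\<close> starts away from 0 whenever its half of \<open>l\<close>
    is nonzero.\<close>
  define z0 where "z0 = (\<lambda>w. joined (sqrt (coll_q 0) *\<^sub>R upper w) (inverse (sqrt (coll_q 0)) *\<^sub>R lower w) :: real^(4+4))"
  have z0_zero: "w = 0" if "z0 w = 0" for w
  proof -
    have "upper w = 0 \<and> lower w = 0"
      using arg_cong[OF that, of upper] arg_cong[OF that, of lower] q0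
        upper_joined[of 0 "0::real^4"] lower_joined[of 0 "0::real^4"]
      by (simp add: z0_def)
    thus ?thesis using joined_upper_lower[of w] by simp
  qed
  obtain Z where Z: "Z 0 = z0 (upper l)" "\<And>\<tau>. (Z has_vector_derivative (symp_J ** coll_B R \<tau>) *v Z \<tau>) (at \<tau>)"
    using collision_solution_exists by metis
  obtain Z' where Z': "Z' 0 = z0 (lower l)" "\<And>\<tau>. (Z' has_vector_derivative (symp_J ** coll_B R \<tau>) *v Z' \<tau>) (at \<tau>)"
    using collision_solution_exists by metis
  have e_lim_r: "(\<lambda>n. e (r n)) \<longlonglongrightarrow> 1"
    using LIMSEQ_subseq_LIMSEQ[OF e_lim r] by (simp add: o_def)
  have tendsto_joined: "(\<lambda>n. joined (f n) (h n)) \<longlonglongrightarrow> joined a b" if "f \<longlonglongrightarrow> a" "h \<longlonglongrightarrow> b"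
    for f h :: "nat \<Rightarrow> real^4" and a b
    using bounded_linear.tendsto[OF bounded_linear_joined tendsto_Pair[OF that]] by simp
  have limZ: "(\<lambda>n. rescaled (p (r n)) (x (r n)) \<tau>) \<longlonglongrightarrow> Z \<tau>" for \<tau>
  proof (rule collision_limit[OF e(1,2) e_lim_r sol(1) Z(2)])
    show "(\<lambda>n. rescaled (p (r n)) (x (r n)) 0) \<longlonglongrightarrow> Z 0"
      unfolding Z(1) z0_def rescaled_def true_anomaly_props(4)
      using up[OF up[OF l]] lo[OF up[OF l]]
      by (intro tendsto_joined tendsto_scaleR tendsto_const) (simp_all add: v_def o_def)
  qed
  have limZ': "(\<lambda>n. rescaled (p' (r n)) (x' (r n)) \<tau>) \<longlonglongrightarrow> Z' \<tau>" for \<tau>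
  proof (rule collision_limit[OF e(1,2) e_lim_r sol(2) Z'(2)])
    show "(\<lambda>n. rescaled (p' (r n)) (x' (r n)) 0) \<longlonglongrightarrow> Z' 0"
      unfolding Z'(1) z0_def rescaled_def true_anomaly_props(4)
      using up[OF lo[OF l]] lo[OF lo[OF l]]
      by (intro tendsto_joined tendsto_scaleR tendsto_const) (simp_all add: v_def o_def)
  qed
  \<comment> \<open>For each fixed \<tau> the comparison of norms holds for all large
    \<open>n\<close>, and \<open>C\<close> depends on neither \<open>n\<close> nor \<tau>.\<close>
  have bound: "(norm (Z \<tau>))\<^sup>2 + (norm (Z' \<tau>))\<^sup>2 \<le> 2 * C" for \<tau>
  proof (rule tendsto_upperbound)
    show "(\<lambda>n. (norm (rescaled (p (r n)) (x (r n)) \<tau>))\<^sup>2 + (norm (rescaled (p' (r n)) (x' (r n)) \<tau>))\<^sup>2)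
        \<longlonglongrightarrow> (norm (Z \<tau>))\<^sup>2 + (norm (Z' \<tau>))\<^sup>2"
      by (intro tendsto_intros limZ limZ')
    have "\<forall>\<^sub>F n in sequentially. 1 - (coll_q \<tau>)\<^sup>2 < e (r n)"
      by (rule order_tendstoD(1)[OF e_lim_r]) (use coll_q_bounds(1)[of \<tau>] in simp)
    thus "\<forall>\<^sub>F n in sequentially. (norm (rescaled (p (r n)) (x (r n)) \<tau>))\<^sup>2
        + (norm (rescaled (p' (r n)) (x' (r n)) \<tau>))\<^sup>2 \<le> 2 * C"
    proof eventually_elim
      case (elim n)
      hence q: "1 - e (r n) \<le> (coll_q \<tau>)\<^sup>2" by simp
      show ?case
        using norm_rescaled_le[OF e(1,2) q, of "p (r n)" "x (r n)"]
          norm_rescaled_le[OF e(1,2) q, of "p' (r n)" "x' (r n)"]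
          C(2)[OF e(3,1,2) F true_anomaly_props(3), of "r n" \<tau>] by linarith
    qed
  qed simp
  have bd: "bounded (range f)" if "\<And>\<tau>. (norm (f \<tau>))\<^sup>2 \<le> 2 * C" for f :: "real \<Rightarrow> real^(4+4)"
    unfolding bounded_iff using that by (auto intro!: exI[of _ "sqrt (2 * C)"] real_le_rsqrt)
  have "bounded (range Z)" "bounded (range Z')"
    by (rule bd; use bound in \<open>smt (verit) zero_le_power2\<close>)+
  hence "Z 0 = 0" "Z' 0 = 0" using nondeg Z(2) Z'(2) unfolding collision_nondegenerate_def by blast+
  \<comment> \<open>One of the two limits might vanish on its own; that both do contradicts
    \<open>norm l = 1\<close>.\<close>
  hence "upper l = 0" "lower l = 0" using z0_zero Z(1) Z'(1) by metis+
  hence "l = 0" using joined_upper_lower[of l] by simp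
  thus False using norm_l by simp
qed

theorem corollary1p5:
  fixes mc :: real
  shows "(mc \<in> {0 ..< (81 + 64 * sqrt 3) / 249} \<and> collision_nondegenerate (R_13gon mc) \<longrightarrow>
            (\<exists>\<epsilon>>0. \<forall>e\<in>{0..<1}. 1 - e < \<epsilon> \<longrightarrow> ere_hyperbolic (R_13gon mc) e)) \<and>
         (mc \<in> {0 ..< sqrt 3 / 24} \<longrightarrow>
            (\<forall>e\<in>{0..<1}. ere_hyperbolic (R_13gon mc) e))"
proof (intro conjI impI ballI)
  assume "mc \<in> {0 ..< (81 + 64 * sqrt 3) / 249} \<and> collision_nondegenerate (R_13gon mc)"
  hence mc: "0 \<le> mc" "mc < (81 + 64 * sqrt 3) / 249" and "collision_nondegenerate (R_13gon mc)"
    by auto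
  moreover obtain \<delta> where "\<delta> > 0" "\<And>x. \<delta> * (x \<bullet> x) \<le> x \<bullet> (R_13gon mc *v x)"
    using R_13gon_form_coercive[OF zero_le_one mc(1) b_coef_less(2)[OF mc]] by auto
  ultimately show "\<exists>\<epsilon>>0. \<forall>e\<in>{0..<1}. 1 - e < \<epsilon> \<longrightarrow> ere_hyperbolic (R_13gon mc) e"
    by (intro hyperbolic_near_collision)
next
  fix e :: real
  assume "mc \<in> {0 ..< sqrt 3 / 24}" and e: "e \<in> {0..<1}"
  hence mc: "0 \<le> mc" "mc < sqrt 3 / 24" by auto
  obtain \<delta> where "\<delta> > 0" "\<And>x. (1 + \<delta>) * (x \<bullet> x) \<le> x \<bullet> (R_13gon mc *v x)"
    using R_13gon_form_coercive[OF order_refl mc(1) b_coef_less(1)[OF mc]] by auto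
  thus "ere_hyperbolic (R_13gon mc) e"
    using e by (intro hyperbolic_of_form_ge) auto
qed

end
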